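(* Let $m,n$ be positive even integers. For every feasible representative pair $(T,M)$ in $G_{m,n}$, $$|T|+\frac56|M|\le\frac{mn}{2}.$$ If $q=|T|+|M|-\frac{mn}{2}$, then $$\frac{mn}{2}-|T|\ge 5q,\qquad |M|\ge 6q.$$ In particular, for every integer $d\ge 1$, any sub-quorum coloring of $G_{m,n}$ with $F(m,n)+d=mn/2+d$ colors has at least $6d$ non-singleton color classes.
   Context: $G_{m,n}=P_m\square P_n$ is the rectangular grid graph ($P_k$ the path on $k$ vertices). A feasible representative pair in a graph $G$ is a pair $(T,M)$ where $M$ is a matching of $G$ (a set of pairwise vertex-disjoint edges, possibly empty), $V(M)$ is the set of endpoints of edges of $M$, $T\subseteq V(G)$ is disjoint from $V(M)$, and every $t\in T$ has at most one neighbor in $T\cup V(M)$. A sub-quorum coloring of $G$ with $k$ colors is an onto partial map $f:V(G)\dashrightarrow\{1,\ldots,k\}$ such that, with $S=\operatorname{dom}(f)$, every $v\in S$ satisfies $|\{u\in N_G[v]\cap S: f(u)=f(v)\}|\ge\frac12|N_G[v]\cap S|$, where $N_G[v]$ is the closed neighborhood of $v$. Its color classes are the sets $f^{-1}(i)$. Here $$F(m,n)=\max\left\{\left\lceil\tfrac m2\right\rceil\left\lceil\tfrac{2n}3\right\rceil+\left\lfloor\tfrac m2\right\rfloor\left\lfloor\tfrac n3\right\rfloor,\ \left\lceil\tfrac n2\right\rceil\left\lceil\tfrac{2m}3\right\rceil+\left\lfloor\tfrac n2\right\rfloor\left\lfloor\tfrac m3\right\rfloor\right\},$$ which equals $mn/2$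 when $m,n$ are both even. *)

theory Defs
  imports Complex_Main
begin

text \<open>Undirected graphs; every edge is intended to be a two-element set of vertices.\<close>

record 'a sgraph =
  verts :: "'a set"
  edges :: "'a set set"

definition path_graph :: "nat \<Rightarrow> nat sgraph" where
  "path_graph k = \<lparr>verts = {1..k}, edges = {{i, i + 1} | i. 1 \<le> i \<and> i + 1 \<le> k}\<rparr>"

definition box_product :: "'a sgraph \<Rightarrow> 'b sgraph \<Rightarrow> ('a \<times> 'b) sgraph"  (infixr "\<box>" 70) where
  "G \<box> H = \<lparr>verts = verts G \<times> verts H,
     edges = {{(a, b), (a, b')} | a b b'. a \<in> verts G \<and> {b, b'} \<in> edges H} \<union>
             {{(a, b), (a', b)} | a a' b. {a, a'} \<in> edges G \<and> b \<in> verts H}\<rparr>"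

definition grid :: "nat \<Rightarrow> nat \<Rightarrow> (nat \<times> nat) sgraph" where
  "grid m n = path_graph m \<box> path_graph n"

definition nbhd :: "'a sgraph \<Rightarrow> 'a \<Rightarrow> 'a set" where
  "nbhd G v = {u. {u, v} \<in> edges G}"

definition closed_nbhd :: "'a sgraph \<Rightarrow> 'a \<Rightarrow> 'a set" where
  "closed_nbhd G v = insert v (nbhd G v)"

definition is_matching :: "'a sgraph \<Rightarrow> 'a set set \<Rightarrow> bool" where
  "is_matching G M \<longleftrightarrow> M \<subseteq> edges G \<and> pairwise disjnt M"

text \<open>The set of endpoints of the edges in \<open>M\<close> is \<open>\<Union>M\<close>. Neighbours are counted with
  \<^const>\<open>card\<close>, so this and the next definition are meant for finite graphs only.\<close>

definition feasible_representative_pair :: "'a sgraph \<Rightarrow> 'a set \<Rightarrow> 'a set set \<Rightarrow> bool" where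
  "feasible_representative_pair G T M \<longleftrightarrow>
     is_matching G M \<and> T \<subseteq> verts G \<and> T \<inter> \<Union>M = {} \<and>
     (\<forall>t\<in>T. card (nbhd G t \<inter> (T \<union> \<Union>M)) \<le> 1)"

definition sub_quorum_coloring :: "'a sgraph \<Rightarrow> nat \<Rightarrow> ('a \<rightharpoonup> nat) \<Rightarrow> bool" where
  "sub_quorum_coloring G k f \<longleftrightarrow>
     dom f \<subseteq> verts G \<and> ran f = {1..k} \<and>
     (\<forall>v\<in>dom f. real (card {u \<in> closed_nbhd G v \<inter> dom f. f u = f v})
                   \<ge> 1 / 2 * real (card (closed_nbhd G v \<inter> dom f)))"

definition color_classes :: "('a \<rightharpoonup> nat) \<Rightarrow> 'a set set" where
  "color_classes f = {{v. f v = Some i} | i. i \<in> ran f}"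

definition F :: "nat \<Rightarrow> nat \<Rightarrow> int" where
  "F m n = max
     (\<lceil>real m / 2\<rceil> * \<lceil>2 * real n / 3\<rceil> + \<lfloor>real m / 2\<rfloor> * \<lfloor>real n / 3\<rfloor>)
     (\<lceil>real n / 2\<rceil> * \<lceil>2 * real m / 3\<rceil> + \<lfloor>real n / 2\<rfloor> * \<lfloor>real m / 3\<rfloor>)"

end

theory Submission
  imports Defs
begin

text \<open>
  Call a vertex occupied if it lies in \<open>T\<close> or in \<open>V(M)\<close>, and let \<open>U\<close> be the set of the other vertices.
  As \<open>|T| + 2|M| + |U| = mn\<close>, the bound \<open>|T| + 5/6 |M| \<le> mn/2\<close> says that \<open>3 (|T| - |U|) \<le> |M|\<close>.
  The proof is by discharging. Since \<open>m\<close> and \<open>n\<close> are even, the grid is cut exactly into blocks of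
  2 by 2 vertices. A block starts with charge \<open>3 (|T| - |U|)\<close>, counted inside the block, every matching edge may
  absorb one unit, and charge is moved until no block has a positive amount left.

  A vertex of \<open>T\<close> has at most one occupied neighbour. Therefore only one kind of block has a positive
  charge: two vertices of \<open>T\<close> on a diagonal, one matched vertex and one empty vertex. Such a
  source has charge 3. It sends everything through the matching edge at its matched vertex; the
  edge absorbs one unit and two units arrive in the next block. The vertices of \<open>T\<close> in the source
  force the vertex next to the point of arrival, along the shared side of the two blocks, to be
  empty. Hence the next block either has negative charge and keeps the two units, or consists of
  one vertex of \<open>T\<close>, one empty vertex and two matched ones. In the latter case it passes the two
  units on through the edge at its second matched vertex (a relay), and one unit arrives in a
  third block. This one keeps the unit or passes it through one more edge (a tail), which absorbs it.

  Two things remain: no edge is used by two routes (lemma \<open>level_mate\<close>), and no block ends with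
  positive charge (lemma \<open>block_le_0\<close>). Both are local. Whenever two routes
  come too close to each other, some vertex of \<open>T\<close> between them has two occupied neighbours. Two
  situations need an extra rule. A block with three matched vertices has charge -3 but may receive
  two units from each of two sources; the fourth unit then leaves through its third matched
  vertex. A block with four matched vertices has charge 0 and must send on what it receives;
  if the edge meant for this lies inside the block, two routes may compete for it. In the
  situation where this can happen the unit is handed instead to the neighbouring block that borders on this edge (a leak),
  whose opposite half is empty.

  The remaining claims follow from the bound. For even \<open>m\<close> and \<open>n\<close> both terms of the maximum
  defining \<open>F\<close> equal \<open>mn/2\<close>. A sub-quorum coloring gives a feasible pair with \<open>|T| + |M|\<close> equal to
  the number of colors: from every color class take an edge inside the class if there is one, and
  a single vertex otherwise; such a vertex is the only one of its color in its closed neighbourhood, so the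
  quorum condition leaves it at most one colored neighbour (lemma \<open>quorum_pair\<close>).
\<close>

section \<open>Configurations on the integer grid\<close>

text \<open>
  A configuration lives on the whole integer plane; cells outside the grid are just unoccupied, so
  that no local argument has to mention the boundary. Edges are named by their left or lower end:
  \<open>hor c x y\<close> joins \<open>(x, y)\<close> to \<open>(x + 1, y)\<close>, and \<open>ver c x y\<close> joins \<open>(x, y)\<close> to \<open>(x, y + 1)\<close>.
\<close>

record configuration =
  rep :: "int \<Rightarrow> int \<Rightarrow> bool"
  hor :: "int \<Rightarrow> int \<Rightarrow> bool"
  ver :: "int \<Rightarrow> int \<Rightarrow> bool"

definition matched :: "configuration \<Rightarrow> int \<Rightarrow> int \<Rightarrow> bool" where
  "matched c x y \<longleftrightarrow> hor c x y \<or> hor c (x - 1) y \<or> ver c x y \<or> ver c x (y - 1)"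

definition occupied :: "configuration \<Rightarrow> int \<Rightarrow> int \<Rightarrow> bool" where
  "occupied c x y \<longleftrightarrow> rep c x y \<or> matched c x y"

definition valid :: "configuration \<Rightarrow> bool" where
  "valid c \<longleftrightarrow> (\<forall>x y.
     (rep c x y \<longrightarrow> \<not> matched c x y) \<and>
     (hor c x y \<longrightarrow> \<not> hor c (x - 1) y) \<and>
     (ver c x y \<longrightarrow> \<not> ver c x (y - 1)) \<and>
     (hor c x y \<or> hor c (x - 1) y \<longrightarrow> \<not> ver c x y \<and> \<not> ver c x (y - 1)) \<and>
     (rep c x y \<longrightarrow>
        \<not> (occupied c (x + 1) y \<and> occupied c (x - 1) y) \<and> \<not> (occupied c x (y + 1) \<and> occupied c x (y - 1)) \<and>
        \<not> ((occupied c (x + 1) y \<or> occupied c (x - 1) y) \<and> (occupied c x (y + 1) \<or> occupied c x (y - 1)))))"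

lemma rep_not_matched: "valid c \<Longrightarrow> rep c x y \<Longrightarrow> \<not> matched c x y"
  by (auto simp: valid_def)

lemma match_unique:
  assumes "valid c"
  shows "(hor c x y \<longrightarrow> \<not> hor c (x - 1) y) \<and> (ver c x y \<longrightarrow> \<not> ver c x (y - 1)) \<and>
    (hor c x y \<or> hor c (x - 1) y \<longrightarrow> \<not> ver c x y \<and> \<not> ver c x (y - 1))"
  using assms unfolding valid_def by blast

lemma rep_nbrs_sparse:
  assumes "valid c" "rep c x y"
  shows "\<not> (occupied c (x + 1) y \<and> occupied c (x - 1) y) \<and> \<not> (occupied c x (y + 1) \<and> occupied c x (y - 1)) \<and>
        \<not> ((occupied c (x + 1) y \<or> occupied c (x - 1) y) \<and> (occupied c x (y + 1) \<or> occupied c x (y - 1)))"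
  using assms unfolding valid_def by blast

text \<open>
  Blocks are the squares \<open>{2i, 2i + 1} \<times> {2j, 2j + 1}\<close>. All local arguments are made at the
  cell \<open>(0, 0)\<close> of the block \<open>{0, 1} \<times> {0, 1}\<close>. The configuration \<open>view x y c\<close> is \<open>c\<close> in coordinates
  that put \<open>(x, y)\<close> there: coordinates are shifted, and reflected in the directions where the
  cell is the upper end of its block. A reflected edge is named by its other end, hence
  the separate map for edges. Together with the exchange of the two axes this provides all
  symmetries of a block.
\<close>

definition cell :: "int \<Rightarrow> int \<Rightarrow> int" where
  "cell x i = (if even x then x + i else x - i)"

definition edge :: "int \<Rightarrow> int \<Rightarrow> int" where
  "edge x i = (if even x then x + i else x - i - 1)"

definition view :: "int \<Rightarrow> int \<Rightarrow> configuration \<Rightarrow> configuration" where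
  "view x y c = \<lparr>rep = \<lambda>i j. rep c (cell x i) (cell y j),
     hor = \<lambda>i j. hor c (edge x i) (cell y j),
     ver = \<lambda>i j. ver c (cell x i) (edge y j)\<rparr>"

definition swap :: "configuration \<Rightarrow> configuration" where
  "swap c = \<lparr>rep = \<lambda>i j. rep c j i, hor = \<lambda>i j. ver c j i, ver = \<lambda>i j. hor c j i\<rparr>"

lemma view_simps [simp]:
  "rep (view x y c) i j = rep c (cell x i) (cell y j)"
  "hor (view x y c) i j = hor c (edge x i) (cell y j)"
  "ver (view x y c) i j = ver c (cell x i) (edge y j)"
  by (simp_all add: view_def)

lemma swap_simps [simp]:
  "rep (swap c) i j = rep c j i" "hor (swap c) i j = ver c j i" "ver (swap c) i j = hor c j i"
  by (simp_all add: swap_def)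

lemma matched_swap [simp]: "matched (swap c) i j = matched c j i"
  by (auto simp: matched_def)

lemma occupied_swap [simp]: "occupied (swap c) i j = occupied c j i"
  by (simp add: occupied_def)

lemma matched_view [simp]: "matched (view x y c) i j = matched c (cell x i) (cell y j)"
  by (cases "even x"; cases "even y") (auto simp: matched_def cell_def edge_def algebra_simps)

lemma occupied_view [simp]: "occupied (view x y c) i j = occupied c (cell x i) (cell y j)"
  by (simp add: occupied_def)

lemma swap_swap [simp]: "swap (swap c) = c"
  by (simp add: swap_def)

lemma swap_view: "swap (view x y c) = view y x (swap c)"
  by (simp add: swap_def view_def)

lemma view_view: "view i j (view x y c) = view (cell x i) (cell y j) c"
  by (cases "even x"; cases "even y"; cases "even i"; cases "even j")
     (auto simp: view_def cell_def edge_def fun_eq_iff algebra_simps)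

lemma valid_swap [simp]: "valid (swap c) \<longleftrightarrow> valid c"
  unfolding valid_def by (simp, blast)

lemma valid_view: "valid c \<Longrightarrow> valid (view x y c)"
proof -
  assume v: "valid c"
  show ?thesis
    unfolding valid_def
  proof (intro allI)
    fix i j
    note m = match_unique[OF v, of "cell x i" "cell y j"]
    note s = rep_nbrs_sparse[OF v, of "cell x i" "cell y j"]
    note w = rep_not_matched[OF v, of "cell x i" "cell y j"]
    have cx: "cell x (i + 1) = (if even x then cell x i + 1 else cell x i - 1)"
      "cell x (i - 1) = (if even x then cell x i - 1 else cell x i + 1)"
      "cell y (j + 1) = (if even y then cell y j + 1 else cell y j - 1)"
      "cell y (j - 1) = (if even y then cell y j - 1 else cell y j + 1)"
      "edge x i = (if even x then cell x i else cell x i - 1)"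
      "edge x (i-1) = (if even x then cell x i - 1 else cell x i)"
      "edge y j = (if even y then cell y j else cell y j - 1)"
      "edge y (j-1) = (if even y then cell y j - 1 else cell y j)"
      by (auto simp: cell_def edge_def)
    show "(rep (view x y c) i j \<longrightarrow> \<not> matched (view x y c) i j) \<and>
     (hor (view x y c) i j \<longrightarrow> \<not> hor (view x y c) (i - 1) j) \<and>
     (ver (view x y c) i j \<longrightarrow> \<not> ver (view x y c) i (j - 1)) \<and>
     (hor (view x y c) i j \<or> hor (view x y c) (i - 1) j \<longrightarrow> \<not> ver (view x y c) i j \<and> \<not> ver (view x y c) i (j - 1)) \<and>
     (rep (view x y c) i j \<longrightarrow>
        \<not> (occupied (view x y c) (i + 1) j \<and> occupied (view x y c) (i - 1) j) \<and> \<not> (occupied (view x y c) i (j + 1) \<and> occupied (view x y c) i (j - 1)) \<and>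
        \<not> ((occupied (view x y c) (i + 1) j \<or> occupied (view x y c) (i - 1) j) \<and> (occupied (view x y c) i (j + 1) \<or> occupied (view x y c) i (j - 1))))"
      unfolding view_simps matched_view occupied_view cx using m s w
      by (cases "even x"; cases "even y"; simp; blast)
  qed
qed

section \<open>Levels\<close>

text \<open>
  The level of a cell is the number of units that its block sends through the matching edge at
  that cell. It is read off from finite patterns around the corner \<open>(0, 0)\<close> of a block. In the
  pictures \<open>o\<close> is that corner, \<open>R\<close> a cell of \<open>T\<close>, \<open>m\<close> a matched cell, \<open>-\<close> or \<open>|\<close> a matching edge, and a dot any other cell.
\<close>

definition source :: "configuration \<Rightarrow> bool" where
  "source c \<longleftrightarrow> matched c 0 0 \<and> rep c 1 0 \<and> rep c 0 1"

(*   R . R .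
     o m-m R     the source is the block on the right; its two units arrive next to o  *)
definition relay_h :: "configuration \<Rightarrow> bool" where
  "relay_h c \<longleftrightarrow> matched c 0 0 \<and> rep c 0 1 \<and> hor c 1 0 \<and> rep c 3 0 \<and> rep c 2 1"

definition relay :: "configuration \<Rightarrow> bool" where
  "relay c \<longleftrightarrow> relay_h c \<or> relay_h (swap c)"

(*   R . R . R .
     o m-m m-m R     a source, a relay and then the block of o, all in one row  *)
definition straight :: "configuration \<Rightarrow> bool" where
  "straight c \<longleftrightarrow> matched c 0 0 \<and> rep c 0 1 \<and> hor c 1 0 \<and> rep c 2 1 \<and> hor c 3 0 \<and> rep c 5 0 \<and> rep c 4 1"

(*   . . R .
     . . m R
         |
     R . m .
     o m-m R     the source lies above the relay  *)
definition bent :: "configuration \<Rightarrow> bool" where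
  "bent c \<longleftrightarrow> matched c 0 0 \<and> rep c 0 1 \<and> hor c 1 0 \<and> rep c 3 0 \<and> ver c 2 1 \<and> rep c 2 3 \<and> rep c 3 2"

(*   . . o m
           |
     R m-m m     the source is on the left and the relay below the block of o
     . R . R                                                                      *)
definition turn :: "configuration \<Rightarrow> bool" where
  "turn c \<longleftrightarrow> matched c 0 0 \<and> ver c 1 (-1) \<and> rep c 1 (-2) \<and> hor c (-1) (-1) \<and> rep c (-2) (-1) \<and> rep c (-1) (-2)"

text \<open>
  After a turn into a block of four matched cells the unit leaves at \<open>o\<close>, the cell above the one
  where the route entered the relay. If \<open>o\<close> is matched to the cell above it, this edge may also be
  claimed by the mirror image of the route, coming from above. The source of that route would force
  the cell \<open>(-2, 1)\<close> to be empty. Whenever this cell is empty, the unit is therefore handed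
  to the block to the left of \<open>o\<close>.
\<close>

definition leak :: "configuration \<Rightarrow> bool" where
  "leak c \<longleftrightarrow> turn c \<and> ver c 0 0 \<and> matched c 1 1 \<and> \<not> occupied c (-2) 1"

definition tail_h :: "configuration \<Rightarrow> bool" where
  "tail_h c \<longleftrightarrow> straight c \<or> bent c \<or>
     turn c \<and> (rep c 0 1 \<or> rep c 1 1 \<or> matched c 0 1 \<and> matched c 1 1 \<and> \<not> leak c)"

text \<open>
  Two sources feed the two neighbours of \<open>o\<close>. The three matched cells and the empty cell of the
  block absorb only three of the four units, and the last one leaves at \<open>o\<close>.
\<close>

definition double :: "configuration \<Rightarrow> bool" where
  "double c \<longleftrightarrow> matched c 0 0 \<and> hor c 1 0 \<and> rep c 3 0 \<and> rep c 2 1 \<and> ver c 0 1 \<and> rep c 0 3 \<and> rep c 1 2"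

definition tail :: "configuration \<Rightarrow> bool" where
  "tail c \<longleftrightarrow> tail_h c \<or> tail_h (swap c) \<or> double c"

definition level :: "configuration \<Rightarrow> nat" where
  "level c = (if source c then 3 else if relay c then 2 else if tail c then 1 else 0)"

lemma source_swap [simp]: "source (swap c) = source c"
  by (auto simp: source_def)

lemma relay_swap [simp]: "relay (swap c) = relay c"
  by (auto simp: relay_def)

lemma double_swap: "double (swap c) = double c"
  by (auto simp: double_def)

lemma tail_swap [simp]: "tail (swap c) = tail c"
  by (auto simp: tail_def double_swap)

lemma level_swap [simp]: "level (swap c) = level c"
  by (simp add: level_def)

lemmas patterns = source_def relay_h_def relay_def straight_def bent_def turn_def leak_def tail_h_def
  double_def tail_def

lemma level_0: "level c = 0 \<longleftrightarrow> \<not> source c \<and> \<not> relay c \<and> \<not> tail c"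
  by (simp add: level_def)

section \<open>No edge pays twice\<close>

lemmas view_eval = swap_simps view_simps matched_swap occupied_swap matched_view occupied_view cell_def edge_def

text \<open>
  Only turns could send a unit through an edge inside a block. If both ends of the edge did so,
  the two turns would be mirror images, and a cell of \<open>T\<close> in the source of one would
  force a cell to be empty that makes the unit of the other one leak.
\<close>

lemma level_inner_edge:
  assumes v: "valid c" and h: "hor c 0 0"
  shows "level c = 0 \<or> level (view 1 0 c) = 0"
  using rep_not_matched[OF v, of 0 0] rep_not_matched[OF v, of 1 0] rep_not_matched[OF v, of 1 1]
    match_unique[OF v, of 0 0] match_unique[OF v, of 1 0] rep_nbrs_sparse[OF v, of 2 "-2"] h
  unfolding level_0 patterns
  by (simp add: view_eval occupied_def matched_def) (smt (verit))

text \<open>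
  For an edge between two blocks the level of one end is fixed in turn to be 3, 2 and 1. Patterns
  with positive level at the other end as well would put two occupied cells next to one of the
  cells of \<open>T\<close> listed in the proofs, or would match the cell \<open>(0, 0)\<close> twice.
\<close>

lemma source_outer_edge:
  assumes v: "valid c" and h: "hor c (-1) 0" and s: "source c"
  shows "level (view (-1) 0 c) = 0"
  using rep_nbrs_sparse[OF v, of 0 1] rep_nbrs_sparse[OF v, of 1 0] h s
  unfolding level_0 patterns
  by (simp add: view_eval occupied_def matched_def)

lemma relay_outer_edge:
  assumes v: "valid c" and h: "hor c (-1) 0" and s: "relay c"
  shows "level (view (-1) 0 c) = 0"
  using rep_nbrs_sparse[OF v, of 0 1] rep_nbrs_sparse[OF v, of 1 "-1"] rep_nbrs_sparse[OF v, of "-1" "1"] rep_nbrs_sparse[OF v, of 0 3]  h s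
  unfolding level_0 patterns
  by (simp add: view_eval occupied_def matched_def) (smt (verit))

lemma tail_outer_edge:
  assumes v: "valid c" and h: "hor c (-1) 0" and s: "tail c"
  shows "level (view (-1) 0 c) = 0"
  using rep_nbrs_sparse[OF v, of 0 1] rep_nbrs_sparse[OF v, of 1 "-1"] rep_nbrs_sparse[OF v, of "-1" "1"] rep_nbrs_sparse[OF v, of 0 3]
   rep_nbrs_sparse[OF v, of 0 5] rep_nbrs_sparse[OF v, of "-1" 3] rep_nbrs_sparse[OF v, of "-2" "-1"] match_unique[OF v, of 0 0] h s
  unfolding level_0 patterns
  by (simp add: view_eval occupied_def matched_def) (smt (verit))

section \<open>Units arriving at a cell\<close>

lemma view_0 [simp]: "view 0 0 c = c"
  by (simp add: view_def cell_def edge_def)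

text \<open>
  What arrives at a matched cell: the level of its partner minus the unit that the edge absorbs;
  truncated subtraction makes it 0 at level 0.
\<close>

definition inflow :: "configuration \<Rightarrow> nat" where
  "inflow c = (if hor c 0 0 then level (view 1 0 c) else if hor c (-1) 0 then level (view (-1) 0 c)
     else if ver c 0 0 then level (view 0 1 c) else if ver c 0 (-1) then level (view 0 (-1) c) else 0) - 1"

definition from_source :: "configuration \<Rightarrow> bool" where
  "from_source c \<longleftrightarrow> hor c (-1) 0 \<and> source (view (-1) 0 c)"

definition from_relay :: "configuration \<Rightarrow> bool" where
  "from_relay c \<longleftrightarrow> hor c (-1) 0 \<and> relay (view (-1) 0 c)"

text \<open>
  The neighbours of a source or relay cell within its block belong to \<open>T\<close> or are matched to cells
  outside the block, so two or three units are never sent through an inner edge.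
\<close>

lemma inner_edge_no_inflow:
  assumes v: "valid c" and h: "hor c 0 0"
  shows "\<not> source (view 1 0 c) \<and> \<not> relay (view 1 0 c)"
  using rep_not_matched[OF v, of 0 0] match_unique[OF v, of 0 0] h
  unfolding patterns
  by (auto simp: view_eval occupied_def matched_def)

lemma inner_edge_no_inflow_ver:
  assumes v: "valid c" and h: "ver c 0 0"
  shows "\<not> source (view 0 1 c) \<and> \<not> relay (view 0 1 c)"
  using inner_edge_no_inflow[of "swap c"] v h by (simp flip: swap_view)

lemma level_le: "level c \<le> 3" by (simp add: level_def)

lemma inflow_le: "inflow c \<le> 2"
  using level_le[of "view 1 0 c"] level_le[of "view (-1) 0 c"] level_le[of "view 0 1 c"] level_le[of "view 0 (-1) c"]
  by (auto simp: inflow_def)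

lemma swap_view_swap: "swap (view (-1) 0 (swap c)) = view 0 (-1) c"
  by (simp add: swap_view)

lemma inflow_2_from_source:
  assumes v: "valid c" and i: "inflow c = 2"
  shows "from_source c \<or> from_source (swap c)"
  using i inner_edge_no_inflow[OF v] inner_edge_no_inflow_ver[OF v]
    source_swap[of "view (-1) 0 (swap c)"]
  by (auto simp: inflow_def from_source_def level_def swap_view_swap split: if_splits)

lemma inflow_origin:
  assumes v: "valid c" and i: "inflow c \<noteq> 0"
  shows "from_source c \<or> from_source (swap c) \<or> from_relay c \<or> from_relay (swap c)"
  using i inner_edge_no_inflow[OF v] inner_edge_no_inflow_ver[OF v]
    source_swap[of "view (-1) 0 (swap c)"] relay_swap[of "view (-1) 0 (swap c)"]
  by (auto simp: inflow_def from_source_def from_relay_def level_def swap_view_swap split: if_splits)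

lemma inflow_swap:
  assumes v: "valid c" shows "inflow (swap c) = inflow c"
  using match_unique[OF v, of 0 0]
    level_swap[of "view (-1) 0 (swap c)"] level_swap[of "view 0 (-1) (swap c)"]
    level_swap[of "view 1 0 (swap c)"] level_swap[of "view 0 1 (swap c)"]
  by (auto simp: inflow_def swap_view)

lemma source_inflow_h:
  assumes v: "valid c" and s: "source c"
  shows "\<not> from_source c \<and> \<not> from_relay c"
  using rep_nbrs_sparse[OF v, of 0 1] s
  unfolding patterns from_source_def from_relay_def
  by (simp add: view_eval occupied_def matched_def) (smt (verit))

lemma source_inflow:
  assumes v: "valid c" and s: "source c"
  shows "inflow c = 0"
  using inflow_origin[OF v] source_inflow_h[OF v s] source_inflow_h[of "swap c"] v s by auto

text \<open>
  A block with two matched cells and a cell of \<open>T\<close> has no capacity, so whatever enters at one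
  matched cell has to leave at the other. Two units enter only along the line through both cells:
  an entry from below would put a cell of \<open>T\<close> at \<open>(0, -1)\<close> between two matched cells.
\<close>

lemma forward_from_source:
  assumes v: "valid c" and w: "matched c 0 0" "matched c 1 0" and t: "rep c 0 1 \<or> rep c 1 1"
    and e: "from_source (view 1 0 c) \<or> from_source (swap (view 1 0 c))"
  shows "source c \<or> relay c"
  using rep_nbrs_sparse[OF v, of 0 "-1"] rep_nbrs_sparse[OF v, of 1 1] w t e
  unfolding patterns from_source_def from_relay_def
  by (simp add: view_eval occupied_def matched_def) (smt (verit))

lemma forward_from_relay:
  assumes v: "valid c" and w: "matched c 0 0" "matched c 1 0" and t: "rep c 0 1 \<or> rep c 1 1"
    and e: "from_relay (view 1 0 c) \<or> from_relay (swap (view 1 0 c))"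
  shows "level c \<noteq> 0"
  using rep_nbrs_sparse[OF v, of 0 "-1"] rep_nbrs_sparse[OF v, of 1 1] w t e
  unfolding patterns from_source_def from_relay_def level_0
  by (simp add: view_eval occupied_def matched_def) (smt (verit))

lemma inflow_forwarded:
  assumes v: "valid c" and w: "matched c 0 0" "matched c 1 0" and t: "rep c 0 1 \<or> rep c 1 1"
  shows "inflow (view 1 0 c) \<le> level c"
proof -
  have v': "valid (view 1 0 c)" using v by (rule valid_view)
  consider "inflow (view 1 0 c) = 0" | "inflow (view 1 0 c) = 1" | "inflow (view 1 0 c) = 2"
    using inflow_le[of "view 1 0 c"] by linarith
  then show ?thesis
  proof cases
    case 2
    then have "level c \<noteq> 0" using inflow_origin[OF v'] forward_from_relay[OF v w t] forward_from_source[OF v w t]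
      by (auto simp: level_0)
    with 2 show ?thesis by linarith
  next
    case 3
    then show ?thesis using inflow_2_from_source[OF v'] forward_from_source[OF v w t]
      by (auto simp: level_def)
  qed simp
qed

text \<open>
  The cell is adjacent to a cell of \<open>T\<close> of the source, whose only occupied neighbour is the source
  cell itself. So a source never feeds a block with four matched cells.
\<close>

lemma from_source_companion:
  assumes v: "valid c" and e: "from_source c"
  shows "\<not> occupied c 0 1"
  using rep_nbrs_sparse[OF v, of "-1" 1] e
  unfolding patterns from_source_def
  by (simp add: view_eval occupied_def matched_def)

lemma full_inflow_le:
  assumes v: "valid c" and w: "matched c 0 1" "matched c 1 0"
  shows "inflow c \<le> 1"
proof -
  have "inflow c \<noteq> 2"
    using inflow_2_from_source[OF v] from_source_companion[OF v] from_source_companion[of "swap c"] v w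
    by (auto simp: occupied_def)
  with inflow_le[of c] show ?thesis by linarith
qed

lemma from_relay_turn:
  assumes v: "valid c" and w: "matched c 0 0" "matched c 1 0" and e: "from_relay (swap (view 1 0 c))"
  shows "turn c"
  using rep_nbrs_sparse[OF v, of 0 "-1"] w e
  unfolding patterns from_source_def from_relay_def level_0
  by (simp add: view_eval occupied_def matched_def) (smt (verit))

text \<open>
  The two turns at \<open>o\<close> would start from the same source cell \<open>(-1, -1)\<close>, matched in two ways.
\<close>

lemma turn_exclusive:
  assumes v: "valid c" and w: "turn c"
  shows "\<not> turn (swap c)"
  using match_unique[OF v, of "-1" "-1"] w
  unfolding patterns
  by (simp add: view_eval occupied_def matched_def)

lemma turn_level:
  assumes "turn c" "matched c 0 1" "matched c 1 1"
  shows "leak c \<or> level c \<noteq> 0"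
  using assms by (auto simp: level_0 tail_def tail_h_def)

lemma double_inflow:
  assumes v: "valid c" and w: "matched c 0 0" "matched c 1 0" "matched c 0 1"
    and e: "from_source (view 1 0 c) \<or> from_source (swap (view 1 0 c))"
       "from_source (view 0 1 c) \<or> from_source (swap (view 0 1 c))"
  shows "double c"
  using rep_nbrs_sparse[OF v, of 0 "-1"] rep_nbrs_sparse[OF v, of "-1" 0] w e
  unfolding patterns from_source_def from_relay_def
  by (simp add: view_eval occupied_def matched_def) (smt (verit))

text \<open>
  The route that reaches the middle cell would have its source next to the source or the relay of
  one of the two other routes. So a block with three matched cells receives four units only in the
  situation of \<open>double_inflow\<close>.
\<close>

lemma no_triple_inflow:
  assumes v: "valid c" and w: "matched c 0 0" "matched c 1 0" "matched c 0 1" "\<not> occupied c 1 1"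
    and e: "from_relay c \<or> from_relay (swap c)" "from_source (view 1 0 c) \<or> from_source (swap (view 1 0 c))"
       "from_source (view 0 1 c) \<or> from_source (swap (view 0 1 c)) \<or> from_relay (view 0 1 c) \<or> from_relay (swap (view 0 1 c))"
  shows False
  using rep_nbrs_sparse[OF v, of 0 "-1"] rep_nbrs_sparse[OF v, of "-1" 0] rep_nbrs_sparse[OF v, of "-1" 1] rep_nbrs_sparse[OF v, of 0 3]
    rep_nbrs_sparse[OF v, of 1 "-1"] rep_nbrs_sparse[OF v, of 3 0] rep_nbrs_sparse[OF v, of "-1" 3] match_unique[OF v, of "-1" 0]
    rep_not_matched[OF v, of "-1" 0] w e
  unfolding patterns from_source_def from_relay_def
  by (simp add: view_eval occupied_def matched_def) (smt (verit))

text \<open>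
  The lower right cell is adjacent to a cell of \<open>T\<close> of the source from which the unit came, and
  the upper right cell is empty by the definition of a leak. An empty half leaves room for
  all leaks that a block may receive.
\<close>

lemma leak_target:
  assumes v: "valid c" and l: "leak (view (-1) 0 c)"
  shows "\<not> occupied c 1 0" "\<not> occupied c 1 1" "\<not> rep c 0 0" "\<not> (rep c 0 1 \<and> matched c 0 0)"
  using match_unique[OF v, of "-1" 0] match_unique[OF v, of 0 "-1"] rep_nbrs_sparse[OF v, of 0 0] rep_nbrs_sparse[OF v, of 0 1] rep_nbrs_sparse[OF v, of 1 "-1"]
     rep_not_matched[OF v, of 0 1] l
  unfolding patterns
     apply (simp_all add: view_eval occupied_def matched_def)
  by (smt (verit))+

section \<open>The balance of a block\<close>

lemma inflow_matched: "inflow c \<noteq> 0 \<Longrightarrow> matched c 0 0"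
  by (auto simp: inflow_def matched_def split: if_splits)

text \<open>
  A cell's contribution to the charge of its block, and below what the cell keeps after all
  transfers. In \<open>balance\<close> the leaks received are those of the cells across the left and
  lower sides, seen from the corner.
\<close>

definition excess :: "configuration \<Rightarrow> int" where
  "excess c = (if rep c 0 0 then 3 else if matched c 0 0 then 0 else -3)"

definition balance :: "configuration \<Rightarrow> int" where
  "balance c = excess c + int (inflow c) + of_bool (leak (view (-1) 0 c)) + of_bool (leak (view (-1) 0 (swap c)))
     - int (level c) - of_bool (leak c) - of_bool (leak (swap c))"

definition block :: "configuration \<Rightarrow> int" where
  "block c = balance c + balance (view 1 0 c) + balance (view 0 1 c) + balance (view 1 1 c)"

lemma excess_swap [simp]: "excess (swap c) = excess c"
  by (simp add: excess_def)

lemma balance_swap: "valid c \<Longrightarrow> balance (swap c) = balance c"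
  by (simp add: balance_def inflow_swap)

lemma block_swap: "valid c \<Longrightarrow> block (swap c) = block c"
  by (simp add: block_def balance_swap valid_view flip: swap_view)

lemma block_view: "block (view 1 0 c) = block c" "block (view 0 1 c) = block c"
  by (simp_all add: block_def view_view cell_def)

text \<open>
  The right half is empty and contributes -6. At most two leaks come through each side, and each
  further side in use requires the half opposite to it to be empty as well.
\<close>

lemma block_le_0_if_leak:
  assumes v: "valid c" and l: "leak (view (-1) 0 c)"
  shows "block c \<le> 0"
proof -
  let ?b = "view 1 0 c" and ?u = "view 0 1 c" and ?d = "view 1 1 c"
  note f = leak_target[OF v l]
  have vb: "valid ?b" "valid ?u" "valid ?d" using v by (auto intro: valid_view)
  have out: "inflow ?b = 0" "inflow ?d = 0" "excess ?b = -3" "excess ?d = -3"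
    using inflow_matched[of ?b] inflow_matched[of ?d] f by (auto simp: view_eval occupied_def excess_def)
  have left: "excess c + int (inflow c) + excess ?u + int (inflow ?u) \<le> (if occupied c 0 0 then 2 else -3) + (if occupied c 0 1 then 2 else -3)"
    if "\<not> rep c 0 1"
  proof -
    have "int (inflow c) \<le> (if matched c 0 0 then 2 else 0)" "int (inflow ?u) \<le> (if matched c 0 1 then 2 else 0)"
      using inflow_matched[of c] inflow_matched[of ?u] inflow_le[of c] inflow_le[of ?u] by (auto simp: view_eval)
    then show ?thesis using f(3) that by (auto simp: view_eval occupied_def excess_def split: if_splits)
  qed
  have left': "excess c + int (inflow c) + excess ?u + int (inflow ?u) = 0 \<and> \<not> occupied c 0 0" if "rep c 0 1"
  proof -
    have "inflow c = 0" "inflow ?u = 0" "\<not> matched c 0 0" "\<not> matched c 0 1"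
      using inflow_matched[of c] inflow_matched[of ?u] f(4) that rep_not_matched[OF v that] by (auto simp: view_eval)
    then show ?thesis using f(3) that by (simp add: view_eval occupied_def excess_def)
  qed
  have r: "of_bool (leak (view (-1) 0 ?b)) + of_bool (leak (view (-1) 0 ?d)) \<le> (if occupied c 0 0 \<or> occupied c 0 1 then 0 else 2 :: int)"
    using leak_target[OF vb(1)] leak_target[OF vb(3)] by (auto simp: view_eval of_bool_def)
  have d: "of_bool (leak (view (-1) 0 (swap c))) + of_bool (leak (view (-1) 0 (swap ?b))) \<le> (if occupied c 0 1 then 0 else 2 :: int)"
    using leak_target[of "swap c"] leak_target[of "swap ?b"] vb v by (auto simp: view_eval of_bool_def)
  have u: "of_bool (leak (view (-1) 0 (swap ?u))) + of_bool (leak (view (-1) 0 (swap ?d))) \<le> (if occupied c 0 0 then 0 else 2 :: int)"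
    using leak_target[of "swap ?u"] leak_target[of "swap ?d"] vb v by (auto simp: view_eval of_bool_def)
  have l: "of_bool (leak (view (-1) 0 c)) + of_bool (leak (view (-1) 0 ?u)) \<le> (2 :: int)"
    by (auto simp: of_bool_def)
  have "block c \<le> (excess c + int (inflow c) + excess ?u + int (inflow ?u)) - 6
     + (of_bool (leak (view (-1) 0 ?b)) + of_bool (leak (view (-1) 0 ?d)))
     + (of_bool (leak (view (-1) 0 (swap c))) + of_bool (leak (view (-1) 0 (swap ?b))))
     + (of_bool (leak (view (-1) 0 (swap ?u))) + of_bool (leak (view (-1) 0 (swap ?d))))
     + (of_bool (leak (view (-1) 0 c)) + of_bool (leak (view (-1) 0 ?u)))"
    unfolding block_def balance_def out by simp
  also have "\<dots> \<le> (excess c + int (inflow c) + excess ?u + int (inflow ?u)) - 4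
     + (if occupied c 0 0 \<or> occupied c 0 1 then 0 else 2) + (if occupied c 0 1 then 0 else 2) + (if occupied c 0 0 then 0 else 2)"
    using r d u l by linarith
  also have "\<dots> \<le> 0"
    using left left' by (cases "rep c 0 1"; cases "occupied c 0 0"; cases "occupied c 0 1") (auto simp: occupied_def)
  finally show ?thesis .
qed

text \<open>
  In a block of four matched cells a unit that enters at one cell leaves at a neighbouring
  one, namely where the route turns; by \<open>turn_exclusive\<close> distinct entries use distinct exits.
\<close>

lemma full_inflow:
  assumes v: "valid c" and w: "matched c 0 0" "matched c 1 0" "matched c 0 1" "matched c 1 1"
  shows "inflow (view 1 0 c) \<le> of_bool (turn c) + of_bool (turn (swap (view 1 1 c)))"
proof -
  let ?b = "view 1 0 c"
  let ?d = "swap (view 1 1 c)"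
  have vb: "valid ?b" "valid ?d" "valid (view 0 1 (swap c))" using v by (auto intro: valid_view)
  have "inflow ?b \<le> 1" using full_inflow_le[OF vb(1)] w by (simp add: view_eval)
  moreover have "inflow ?b \<noteq> 0 \<Longrightarrow> turn c \<or> turn ?d"
    using inflow_origin[OF vb(1)] from_relay_turn[OF v w(1,2)] from_relay_turn[OF vb(2)] w
      from_source_companion[OF vb(1)] from_source_companion[of "swap ?b"] vb
    by (auto simp: view_eval occupied_def swap_view view_view)
  ultimately show ?thesis by (cases "inflow ?b = 0") (auto simp: of_bool_def)
qed

lemma full_outflow:
  assumes v: "valid c" and w: "matched c 0 0" "matched c 1 0" "matched c 0 1" "matched c 1 1"
  shows "of_bool (turn c) + of_bool (turn (swap c)) \<le> int (level c) + of_bool (leak c) + of_bool (leak (swap c))"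
  using turn_level[of c] turn_level[of "swap c"] turn_exclusive[OF v] w by (auto simp: of_bool_def)

text \<open>
  The charge -3 of three matched cells and one empty cell absorbs three units. The only larger
  inflow is two units at both neighbours of the middle cell, which then has level 1.
\<close>

lemma three_matched_balance:
  assumes v: "valid c" and w: "matched c 0 0" "matched c 1 0" "matched c 0 1" "\<not> occupied c 1 1"
  shows "inflow c + inflow (view 1 0 c) + inflow (view 0 1 c) \<le> level c + 3"
proof -
  let ?b = "view 1 0 c" and ?u = "view 0 1 c"
  have vb: "valid ?b" "valid ?u" "valid (swap c)" using v by (auto intro: valid_view)
  have c1: "inflow c \<le> 1" using full_inflow_le[OF v] w by simp
  have dd: "level c \<noteq> 0" if "inflow ?b = 2" "inflow ?u = 2"
    using double_inflow[OF v w(1-3)] inflow_2_from_source[OF vb(1)] inflow_2_from_source[OF vb(2)] that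
    by (auto simp: level_0 tail_def)
  have in1: "from_relay c \<or> from_relay (swap c)" if "inflow c \<noteq> 0"
    using inflow_origin[OF v that] from_source_companion[OF v] from_source_companion[OF vb(3)] w by (auto simp: occupied_def)
  have x1: "inflow ?u = 0" if "inflow c \<noteq> 0" "inflow ?b = 2"
    using no_triple_inflow[OF v w] in1 inflow_2_from_source[OF vb(1)] inflow_origin[OF vb(2)] that by blast
  have x2: "inflow ?b = 0" if "inflow c \<noteq> 0" "inflow ?u = 2"
    using no_triple_inflow[of "swap c"] w in1 inflow_2_from_source[OF vb(2)] inflow_origin[OF vb(1)] that v
    by (auto simp flip: swap_view)
  show ?thesis
    using c1 dd x1 x2 inflow_le[of ?b] inflow_le[of ?u] by linarith
qed

lemma source_balance: "valid c \<Longrightarrow> source c \<Longrightarrow> inflow c = 0 \<and> level c = 3"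
  by (simp add: source_inflow level_def)

definition cell_excess :: "bool \<Rightarrow> bool \<Rightarrow> int" where "cell_excess t m = (if t then 3 else if m then 0 else - 3)"
text \<open>
  The arithmetic behind \<open>block_le_0_if_no_leak\<close>. The cells \<open>(0, 0)\<close>, \<open>(1, 0)\<close>, \<open>(0, 1)\<close>, \<open>(1, 1)\<close>
  are numbered 0 to 3; \<open>t\<close> stands for membership in \<open>T\<close>, \<open>m\<close> for matched, \<open>x\<close> for inflow and \<open>y\<close> for
  level. The premises \<open>src\<close>, \<open>rel\<close> and \<open>co\<close> settle sources, two matched cells beside a cell of \<open>T\<close>, and
  three matched cells; every other block has enough empty cells to absorb two units at each of
  its matched cells.
\<close>

lemma block_arith:
  fixes x0 x1 x2 x3 y0 y1 y2 y3 :: nat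
  assumes False: "\<not> (m0 \<and> m1 \<and> m2 \<and> m3)"
   and iso: "t0 \<longrightarrow> \<not> ((t1 \<or> m1) \<and> (t2 \<or> m2))" "t1 \<longrightarrow> \<not> ((t0 \<or> m0) \<and> (t3 \<or> m3))"
      "t2 \<longrightarrow> \<not> ((t0 \<or> m0) \<and> (t3 \<or> m3))" "t3 \<longrightarrow> \<not> ((t1 \<or> m1) \<and> (t2 \<or> m2))"
      "\<not> (t0 \<and> m0)" "\<not> (t1 \<and> m1)" "\<not> (t2 \<and> m2)" "\<not> (t3 \<and> m3)"
   and src: "m0 \<and> t1 \<and> t2 \<longrightarrow> x0 = 0 \<and> y0 = 3"
     "m1 \<and> t0 \<and> t3 \<longrightarrow> x1 = 0 \<and> y1 = 3" "m2 \<and> t3 \<and> t0 \<longrightarrow> x2 = 0 \<and> y2 = 3" "m3 \<and> t2 \<and> t1 \<longrightarrow> x3 = 0 \<and> y3 = 3"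
   and rel: "m0 \<and> m1 \<and> (t2 \<or> t3) \<longrightarrow> x0 \<le> y1 \<and> x1 \<le> y0"
     "m2 \<and> m3 \<and> (t0 \<or> t1) \<longrightarrow> x2 \<le> y3 \<and> x3 \<le> y2"
     "m0 \<and> m2 \<and> (t1 \<or> t3) \<longrightarrow> x0 \<le> y2 \<and> x2 \<le> y0"
     "m1 \<and> m3 \<and> (t0 \<or> t2) \<longrightarrow> x1 \<le> y3 \<and> x3 \<le> y1"
   and co: "m0 \<and> m1 \<and> m2 \<and> \<not> m3 \<and> \<not> t3 \<longrightarrow> x0 + x1 + x2 \<le> y0 + 3"
     "m0 \<and> m1 \<and> \<not> m2 \<and> \<not> t2 \<and> m3 \<longrightarrow> x1 + x0 + x3 \<le> y1 + 3"
     "m0 \<and> \<not> m1 \<and> \<not> t1 \<and> m2 \<and> m3 \<longrightarrow> x2 + x3 + x0 \<le> y2 + 3"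
     "\<not> m0 \<and> \<not> t0 \<and> m1 \<and> m2 \<and> m3 \<longrightarrow> x3 + x2 + x1 \<le> y3 + 3"
   and x: "x0 \<le> (if m0 then 2 else 0)" "x1 \<le> (if m1 then 2 else 0)" "x2 \<le> (if m2 then 2 else 0)" "x3 \<le> (if m3 then 2 else 0)"
  shows "cell_excess t0 m0 + cell_excess t1 m1 + cell_excess t2 m2 + cell_excess t3 m3 + int x0 + int x1 + int x2 + int x3 - int y0 - int y1 - int y2 - int y3 \<le> 0"
  apply (cases t0; cases t1; cases t2; cases t3)
  using assms apply (simp_all add: cell_excess_def cong: if_cong)
  apply (cases m0; cases m1; cases m2; cases m3; simp)+
  done

lemma block_le_0_if_no_leak:
  assumes v: "valid c"
    and l: "\<not> leak (view (-1) 0 c)" "\<not> leak (view (-1) 0 (view 1 0 c))"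
      "\<not> leak (view (-1) 0 (view 0 1 c))" "\<not> leak (view (-1) 0 (view 1 1 c))"
      "\<not> leak (view (-1) 0 (swap c))" "\<not> leak (view (-1) 0 (swap (view 1 0 c)))"
      "\<not> leak (view (-1) 0 (swap (view 0 1 c)))" "\<not> leak (view (-1) 0 (swap (view 1 1 c)))"
  shows "block c \<le> 0"
proof -
  let ?b = "view 1 0 c" and ?u = "view 0 1 c" and ?d = "view 1 1 c"
  have vb: "valid ?b" "valid ?u" "valid ?d" using v by (auto intro: valid_view)
  have vv: "view 1 0 ?b = c" "view 0 1 ?u = c" "view 0 1 ?d = ?b" "view 1 0 ?d = ?u" "view 1 0 ?u = ?d" "view 0 1 ?b = ?d"
    "view 1 1 ?b = ?u" "view 1 1 ?u = ?b" "view 1 1 ?d = c"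
    by (simp_all add: view_view cell_def)
  define T where "T = (\<lambda>i j. rep c i j)"
  define M where "M = (\<lambda>i j. matched c i j)"
  have sw: "inflow (swap x) = inflow x" if "valid x" for x using that by (rule inflow_swap)
  have blk: "block c = excess c + excess ?b + excess ?u + excess ?d
     + int (inflow c) + int (inflow ?b) + int (inflow ?u) + int (inflow ?d)
     - (int (level c) + of_bool (leak c) + of_bool (leak (swap c)))
     - (int (level ?b) + of_bool (leak ?b) + of_bool (leak (swap ?b)))
     - (int (level ?u) + of_bool (leak ?u) + of_bool (leak (swap ?u)))
     - (int (level ?d) + of_bool (leak ?d) + of_bool (leak (swap ?d)))"
    unfolding block_def balance_def using l by simp
  have lk: "0 \<le> (of_bool (leak x) :: int)" for x by simp
  have in0: "inflow c \<le> (if M 0 0 then 2 else 0)" "inflow ?b \<le> (if M 1 0 then 2 else 0)"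
      "inflow ?u \<le> (if M 0 1 then 2 else 0)" "inflow ?d \<le> (if M 1 1 then 2 else 0)"
    using inflow_matched[of c] inflow_matched[of ?b] inflow_matched[of ?u] inflow_matched[of ?d] inflow_le
    by (auto simp: view_eval M_def)
  have ex: "excess c = (if T 0 0 then 3 else if M 0 0 then 0 else - 3)"
    "excess ?b = (if T 1 0 then 3 else if M 1 0 then 0 else - 3)"
    "excess ?u = (if T 0 1 then 3 else if M 0 1 then 0 else - 3)"
    "excess ?d = (if T 1 1 then 3 else if M 1 1 then 0 else - 3)"
    by (simp_all add: excess_def view_eval T_def M_def)
  have iso: "T 0 0 \<longrightarrow> \<not> ((T 1 0 \<or> M 1 0) \<and> (T 0 1 \<or> M 0 1))"
    "T 1 0 \<longrightarrow> \<not> ((T 0 0 \<or> M 0 0) \<and> (T 1 1 \<or> M 1 1))"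
    "T 0 1 \<longrightarrow> \<not> ((T 0 0 \<or> M 0 0) \<and> (T 1 1 \<or> M 1 1))"
    "T 1 1 \<longrightarrow> \<not> ((T 1 0 \<or> M 1 0) \<and> (T 0 1 \<or> M 0 1))"
    "\<not> (T 0 0 \<and> M 0 0)" "\<not> (T 1 0 \<and> M 1 0)" "\<not> (T 0 1 \<and> M 0 1)" "\<not> (T 1 1 \<and> M 1 1)"
    using rep_nbrs_sparse[OF v, of 0 0] rep_nbrs_sparse[OF v, of 1 0] rep_nbrs_sparse[OF v, of 0 1] rep_nbrs_sparse[OF v, of 1 1]
      rep_not_matched[OF v] by (auto simp: T_def M_def occupied_def)
  have src: "M 0 0 \<and> T 1 0 \<and> T 0 1 \<longrightarrow> inflow c = 0 \<and> level c = 3"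
    "M 1 0 \<and> T 0 0 \<and> T 1 1 \<longrightarrow> inflow ?b = 0 \<and> level ?b = 3"
    "M 0 1 \<and> T 1 1 \<and> T 0 0 \<longrightarrow> inflow ?u = 0 \<and> level ?u = 3"
    "M 1 1 \<and> T 0 1 \<and> T 1 0 \<longrightarrow> inflow ?d = 0 \<and> level ?d = 3"
    using source_balance[OF v] source_balance[OF vb(1)] source_balance[OF vb(2)] source_balance[OF vb(3)]
    by (auto simp: source_def view_eval T_def M_def)
  have rel: "M 0 0 \<and> M 1 0 \<and> (T 0 1 \<or> T 1 1) \<longrightarrow> inflow c \<le> level ?b \<and> inflow ?b \<le> level c"
     "M 0 1 \<and> M 1 1 \<and> (T 0 0 \<or> T 1 0) \<longrightarrow> inflow ?u \<le> level ?d \<and> inflow ?d \<le> level ?u"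
     "M 0 0 \<and> M 0 1 \<and> (T 1 0 \<or> T 1 1) \<longrightarrow> inflow c \<le> level ?u \<and> inflow ?u \<le> level c"
     "M 1 0 \<and> M 1 1 \<and> (T 0 0 \<or> T 0 1) \<longrightarrow> inflow ?b \<le> level ?d \<and> inflow ?d \<le> level ?b"
    using inflow_forwarded[OF v] inflow_forwarded[OF vb(1)] inflow_forwarded[OF vb(2)] inflow_forwarded[OF vb(3)]
      inflow_forwarded[of "swap c"] inflow_forwarded[of "swap ?b"] inflow_forwarded[of "swap ?u"] inflow_forwarded[of "swap ?d"]
      v vb sw
    by (auto simp: view_eval T_def M_def vv simp flip: swap_view)
  have co: "M 0 0 \<and> M 1 0 \<and> M 0 1 \<and> \<not> M 1 1 \<and> \<not> T 1 1 \<longrightarrow> inflow c + inflow ?b + inflow ?u \<le> level c + 3"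
    "M 0 0 \<and> M 1 0 \<and> \<not> M 0 1 \<and> \<not> T 0 1 \<and> M 1 1 \<longrightarrow> inflow ?b + inflow c + inflow ?d \<le> level ?b + 3"
    "M 0 0 \<and> \<not> M 1 0 \<and> \<not> T 1 0 \<and> M 0 1 \<and> M 1 1 \<longrightarrow> inflow ?u + inflow ?d + inflow c \<le> level ?u + 3"
    "\<not> M 0 0 \<and> \<not> T 0 0 \<and> M 1 0 \<and> M 0 1 \<and> M 1 1 \<longrightarrow> inflow ?d + inflow ?u + inflow ?b \<le> level ?d + 3"
    using three_matched_balance[OF v] three_matched_balance[OF vb(1)] three_matched_balance[OF vb(2)] three_matched_balance[OF vb(3)]
    by (auto simp: view_eval T_def M_def occupied_def vv)
  have fu: "int (inflow c) + int (inflow ?b) + int (inflow ?u) + int (inflow ?d)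
     \<le> (int (level c) + of_bool (leak c) + of_bool (leak (swap c)))
     + (int (level ?b) + of_bool (leak ?b) + of_bool (leak (swap ?b)))
     + (int (level ?u) + of_bool (leak ?u) + of_bool (leak (swap ?u)))
     + (int (level ?d) + of_bool (leak ?d) + of_bool (leak (swap ?d)))"
    if w: "M 0 0" "M 1 0" "M 0 1" "M 1 1"
  proof -
    have "int (inflow ?b) \<le> of_bool (turn c) + of_bool (turn (swap ?d))"
       "int (inflow c) \<le> of_bool (turn ?b) + of_bool (turn (swap ?u))"
       "int (inflow ?d) \<le> of_bool (turn ?u) + of_bool (turn (swap ?b))"
       "int (inflow ?u) \<le> of_bool (turn ?d) + of_bool (turn (swap c))"
      using full_inflow[OF v] full_inflow[OF vb(1)] full_inflow[OF vb(2)] full_inflow[OF vb(3)] w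
      by (auto simp: view_eval M_def vv of_bool_def split: if_splits)
    moreover have "of_bool (turn c) + of_bool (turn (swap c)) \<le> int (level c) + of_bool (leak c) + of_bool (leak (swap c))"
      "of_bool (turn ?b) + of_bool (turn (swap ?b)) \<le> int (level ?b) + of_bool (leak ?b) + of_bool (leak (swap ?b))"
      "of_bool (turn ?u) + of_bool (turn (swap ?u)) \<le> int (level ?u) + of_bool (leak ?u) + of_bool (leak (swap ?u))"
      "of_bool (turn ?d) + of_bool (turn (swap ?d)) \<le> int (level ?d) + of_bool (leak ?d) + of_bool (leak (swap ?d))"
      using full_outflow[OF v] full_outflow[OF vb(1)] full_outflow[OF vb(2)] full_outflow[OF vb(3)] w
      by (auto simp: view_eval M_def vv)
    ultimately show ?thesis by linarith
  qed
  note lks = lk[of c] lk[of ?b] lk[of ?u] lk[of ?d] lk[of "swap c"] lk[of "swap ?b"] lk[of "swap ?u"] lk[of "swap ?d"]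
  show ?thesis
  proof (cases "M 0 0 \<and> M 1 0 \<and> M 0 1 \<and> M 1 1")
    case True
    then show ?thesis using fu iso unfolding blk ex by simp
  next
    case False
    have "cell_excess (T 0 0) (M 0 0) + cell_excess (T 1 0) (M 1 0) + cell_excess (T 0 1) (M 0 1) + cell_excess (T 1 1) (M 1 1)
      + int (inflow c) + int (inflow ?b) + int (inflow ?u) + int (inflow ?d)
      - int (level c) - int (level ?b) - int (level ?u) - int (level ?d) \<le> 0"
      by (rule block_arith[OF False iso src rel co in0])
    then show ?thesis unfolding blk ex cell_excess_def using lks by linarith
  qed
qed

lemma block_le_0:
  assumes v: "valid c"
  shows "block c \<le> 0"
proof -
  have w: "valid (view i j c)" for i j using v by (rule valid_view)
  have l: "leak (view (-1) 0 x) \<Longrightarrow> block x = block c \<Longrightarrow> valid x \<Longrightarrow> ?thesis" for x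
    using block_le_0_if_leak[of x] by simp
  have d: "view 1 1 c = view 1 0 (view 0 1 c)" by (simp add: view_view cell_def)
  have e: "block (view 1 1 c) = block c" unfolding d by (simp only: block_view)
  show ?thesis
    using block_le_0_if_no_leak[OF v] l[of c] l[of "view 1 0 c"] l[of "view 0 1 c"] l[of "view 1 1 c"]
      l[of "swap c"] l[of "swap (view 1 0 c)"] l[of "swap (view 0 1 c)"] l[of "swap (view 1 1 c)"] v w
    by (auto simp: block_view block_swap e simp del: swap_view)
qed

section \<open>Summation over the grid\<close>

lemma cell_0 [simp]: "cell x 0 = x"
  by (simp add: cell_def)

abbreviation level_at :: "configuration \<Rightarrow> int \<times> int \<Rightarrow> nat" where
  "level_at c p \<equiv> level (view (fst p) (snd p) c)"

definition mate :: "configuration \<Rightarrow> int \<times> int \<Rightarrow> int \<times> int" where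
  "mate c = (\<lambda>(x, y). if hor c x y then (x + 1, y) else if hor c (x - 1) y then (x - 1, y)
     else if ver c x y then (x, y + 1) else (x, y - 1))"

lemma mate_matched:
  assumes v: "valid c" and w: "matched c x y"
  shows "matched c (fst (mate c (x, y))) (snd (mate c (x, y)))" "mate c (mate c (x, y)) = (x, y)"
proof -
  consider "hor c x y" | "hor c (x - 1) y" | "ver c x y" | "ver c x (y - 1)"
    using w by (auto simp: matched_def)
  then have "matched c (fst (mate c (x, y))) (snd (mate c (x, y))) \<and> mate c (mate c (x, y)) = (x, y)"
  proof cases
    case 1
    then show ?thesis using match_unique[OF v, of "x + 1" y] by (simp add: mate_def matched_def)
  next
    case 2
    then show ?thesis using match_unique[OF v, of x y] by (simp add: mate_def matched_def)
  next
    case 3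
    then show ?thesis using match_unique[OF v, of x y] match_unique[OF v, of x "y + 1"]
      by (simp add: mate_def matched_def)
  next
    case 4
    then show ?thesis using match_unique[OF v, of x y] match_unique[OF v, of x "y - 1"]
      by (auto simp: mate_def matched_def)
  qed
  then show "matched c (fst (mate c (x, y))) (snd (mate c (x, y)))" "mate c (mate c (x, y)) = (x, y)"
    by simp_all
qed

lemma cell_cell: "cell (cell x (-1)) (-1) = x"
  by (auto simp: cell_def)

lemma level_matched: "level c \<noteq> 0 \<Longrightarrow> matched c 0 0"
  unfolding level_0 source_def relay_def relay_h_def tail_def tail_h_def straight_def bent_def turn_def double_def
  by (simp, blast)

lemma level_hor:
  assumes v: "valid c" and h: "hor c x y"
  shows "level_at c (x, y) = 0 \<or> level_at c (x + 1, y) = 0"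
proof -
  let ?v = "view x y c"
  have v': "valid ?v" using v by (rule valid_view)
  have *: "level c = 0 \<or> level (view (-1) 0 c) = 0" if "valid c" "hor c (-1) 0" for c
    using tail_outer_edge[OF that] relay_outer_edge[OF that] source_outer_edge[OF that] by (auto simp: level_0)
  show ?thesis
    using level_inner_edge[OF v'] *[OF v'] h by (cases "even x") (auto simp: view_view cell_def[of x] edge_def)
qed

lemma level_mate:
  assumes v: "valid c" and w: "matched c x y"
  shows "level_at c (x, y) = 0 \<or> level_at c (mate c (x, y)) = 0"
proof -
  have ver: "level_at c (x, y) = 0 \<or> level_at c (x, y + 1) = 0" if "ver c x y" for x y
    using level_hor[of "swap c" y x] v that level_swap[of "view x y c"] level_swap[of "view x (y + 1) c"]
    by (simp add: swap_view)
  consider "hor c x y" | "\<not> hor c x y" "hor c (x - 1) y"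
    | "\<not> hor c x y" "\<not> hor c (x - 1) y" "ver c x y"
    | "\<not> hor c x y" "\<not> hor c (x - 1) y" "\<not> ver c x y" "ver c x (y - 1)"
    using w by (auto simp: matched_def)
  then show ?thesis
    using level_hor[OF v, of x y] level_hor[OF v, of "x - 1" y] ver[of x y] ver[of x "y - 1"]
    by cases (auto simp: mate_def)
qed

lemma inflow_mate:
  assumes v: "valid c"
  shows "inflow (view x y c) = (if matched c x y then level_at c (mate c (x, y)) - 1 else 0)"
proof -
  have view: "hor (view x y c) 0 0 = hor c (edge x 0) y" "hor (view x y c) (-1) 0 = hor c (edge x (-1)) y"
    "ver (view x y c) 0 0 = ver c x (edge y 0)" "ver (view x y c) 0 (-1) = ver c x (edge y (-1))"
    by simp_all
  show ?thesis
    unfolding inflow_def view view_view cell_0 matched_def mate_def using match_unique[OF v, of x y]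
    by (cases "even x"; cases "even y"; simp add: edge_def cell_def; blast)
qed

lemma sum_pairs: "(\<Sum>x\<in>{0..<2 * int k}. f x) = (\<Sum>i\<in>{0..<int k}. f (2 * i) + f (2 * i + 1))"
  for f :: "int \<Rightarrow> int"
proof (induction k)
  case (Suc k)
  have "{0..<2 * int (Suc k)} = insert (2 * int k + 1) (insert (2 * int k) {0..<2 * int k})"
    "{0..<int (Suc k)} = insert (int k) {0..<int k}" by auto
  then show ?case using Suc.IH by simp
qed simp

locale grid_conf =
  fixes c :: configuration and a b :: nat
  assumes v: "valid c"
    and supported: "occupied c x y \<Longrightarrow> x \<in> {0..<2 * int a} \<and> y \<in> {0..<2 * int b}"
begin

definition cells where "cells = {0..<2 * int a} \<times> {0..<2 * int b}"
definition reps where "reps = {p \<in> cells. rep c (fst p) (snd p)}"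
definition matched_cells where "matched_cells = {p \<in> cells. matched c (fst p) (snd p)}"

lemma finite_cells: "finite cells" "finite reps" "finite matched_cells"
  by (auto simp: cells_def reps_def matched_cells_def)

lemma matched_iff: "matched c x y \<longleftrightarrow> (x, y) \<in> matched_cells"
  using supported[of x y] by (auto simp: matched_cells_def cells_def occupied_def)

lemma sum_balance: "(\<Sum>p\<in>cells. balance (view (fst p) (snd p) c)) \<le> 0"
proof -
  have "(\<Sum>p\<in>cells. balance (view (fst p) (snd p) c)) = (\<Sum>x\<in>{0..<2 * int a}. \<Sum>y\<in>{0..<2 * int b}. balance (view x y c))"
    by (simp add: cells_def sum.cartesian_product split_def)
  also have "\<dots> = (\<Sum>i\<in>{0..<int a}. \<Sum>j\<in>{0..<int b}. block (view (2 * i) (2 * j) c))"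
    by (simp only: sum_pairs sum.distrib[symmetric] block_def view_view) (simp add: cell_def algebra_simps)
  also have "\<dots> \<le> 0"
    by (intro sum_nonpos block_le_0 valid_view v)
  finally show ?thesis .
qed

lemma sum_excess: "(\<Sum>p\<in>cells. excess (view (fst p) (snd p) c)) = 6 * int (card reps) + 3 * int (card matched_cells) - 12 * int a * int b"
proof -
  have "excess (view (fst p) (snd p) c) = 6 * of_bool (p \<in> reps) + 3 * of_bool (p \<in> matched_cells) - 3" if "p \<in> cells" for p
    using that rep_not_matched[OF v, of "fst p" "snd p"] by (auto simp: excess_def cell_def reps_def matched_cells_def)
  then have "(\<Sum>p\<in>cells. excess (view (fst p) (snd p) c)) = (\<Sum>p\<in>cells. 6 * of_bool (p \<in> reps) + 3 * of_bool (p \<in> matched_cells) - 3)"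
    by (rule sum.cong[OF refl])
  also have "\<dots> = 6 * (\<Sum>p\<in>cells. of_bool (p \<in> reps)) + 3 * (\<Sum>p\<in>cells. of_bool (p \<in> matched_cells)) - 3 * int (card cells)"
    by (simp add: sum.distrib sum_subtractf sum_distrib_left)
  also have "(\<Sum>p\<in>cells. of_bool (p \<in> reps)) = int (card reps)"
    by (simp add: reps_def cells_def Int_def of_bool_def sum.If_cases)
  also have "(\<Sum>p\<in>cells. of_bool (p \<in> matched_cells)) = int (card matched_cells)"
    by (simp add: matched_cells_def cells_def Int_def of_bool_def sum.If_cases)
  also have "int (card cells) = 4 * int a * int b"
    by (simp add: cells_def card_cartesian_product)
  finally show ?thesis by simp
qed

lemma mate_bij: "bij_betw (mate c) matched_cells matched_cells"
proof (rule bij_betw_byWitness[where f' = "mate c"])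
  show "\<forall>p\<in>matched_cells. mate c (mate c p) = p" "\<forall>p\<in>matched_cells. mate c (mate c p) = p"
    using mate_matched(2)[OF v] by (auto simp: matched_cells_def)
  show "mate c ` matched_cells \<subseteq> matched_cells" "mate c ` matched_cells \<subseteq> matched_cells"
    using mate_matched(1)[OF v] by (auto simp: matched_iff)
qed

lemma level_at_matched: "level_at c p \<noteq> 0 \<Longrightarrow> p \<in> matched_cells"
  using level_matched[of "view (fst p) (snd p) c"] matched_iff[of "fst p" "snd p"] by simp

text \<open>
  The partner map permutes the matched cells, so every level is received exactly once, less the
  unit absorbed.
\<close>

lemma sum_inflow: "(\<Sum>p\<in>cells. inflow (view (fst p) (snd p) c)) = (\<Sum>p\<in>cells. level_at c p - 1)"
proof -
  have "(\<Sum>p\<in>cells. inflow (view (fst p) (snd p) c)) = (\<Sum>p\<in>cells. if p \<in> matched_cells then level_at c (mate c p) - 1 else 0)"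
    by (simp only: inflow_mate[OF v] matched_iff prod.collapse)
  also have "\<dots> = (\<Sum>p\<in>matched_cells. level_at c (mate c p) - 1)"
    by (rule sum.mono_neutral_cong_right) (auto simp: cells_def matched_cells_def)
  also have "\<dots> = (\<Sum>p\<in>matched_cells. level_at c p - 1)"
    by (rule sum.reindex_bij_betw[OF mate_bij])
  also have "\<dots> = (\<Sum>p\<in>cells. level_at c p - 1)"
  proof (rule sum.mono_neutral_left)
    have "level_at c p = 0" if "p \<notin> matched_cells" for p using level_at_matched that by blast
    then show "\<forall>p\<in>cells - matched_cells. level_at c p - 1 = 0" by simp
  qed (auto simp: cells_def matched_cells_def)
  finally show ?thesis .
qed

definition payers where "payers = {p \<in> cells. level_at c p \<noteq> 0}"

text \<open>
  The partner of a cell with positive level has level 0, so at most half of the matched cells pay.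
\<close>

lemma card_payers: "2 * card payers \<le> card matched_cells"
proof -
  have PW: "payers \<subseteq> matched_cells" using level_at_matched by (auto simp: payers_def)
  have "mate c ` payers \<subseteq> matched_cells - payers"
  proof
    fix q assume "q \<in> mate c ` payers"
    then obtain x y where q: "q = mate c (x, y)" "(x, y) \<in> payers" by force
    then have "matched c x y" using PW matched_iff by blast
    then have "level_at c (x, y) = 0 \<or> level_at c q = 0" unfolding q(1) by (rule level_mate[OF v])
    moreover have "q \<in> matched_cells" using bij_betwE[OF mate_bij] PW q by blast
    ultimately show "q \<in> matched_cells - payers" using q(2) by (auto simp: payers_def)
  qed
  then have "card (mate c ` payers) \<le> card (matched_cells - payers)"
    using finite_cells by (intro card_mono) auto
  moreover have "card (mate c ` payers) = card payers"
    using mate_bij PW by (intro card_image) (auto simp: bij_betw_def intro: inj_on_subset)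
  moreover have "card (matched_cells - payers) = card matched_cells - card payers"
    using PW finite_cells by (intro card_Diff_subset) (auto intro: finite_subset)
  ultimately show ?thesis using card_mono[OF finite_cells(3) PW] by linarith
qed

text \<open>
  No leak leaves the grid: the source cell of the turn lies in the column that
  receives the leak, and the leaking cell lies in its row.
\<close>

lemma leak_hor:
  "(\<Sum>p\<in>cells. of_bool (leak (view (fst p) (snd p) c))) \<le> (\<Sum>p\<in>cells. of_bool (leak (view (-1) 0 (view (fst p) (snd p) c))) :: int)"
proof -
  let ?L = "{p \<in> cells. leak (view (fst p) (snd p) c)}" and ?K = "{p \<in> cells. leak (view (-1) 0 (view (fst p) (snd p) c))}"
  let ?h = "\<lambda>p. (cell (fst p) (-1), snd p)"
  have "?h ` ?L \<subseteq> ?K"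
  proof
    fix q assume "q \<in> ?h ` ?L"
    then obtain x y where xy: "(x, y) \<in> cells" "leak (view x y c)" "q = (cell x (-1), y)" by auto
    have "matched (view x y c) (-1) (-1)"
      using xy(2) by (auto simp: leak_def turn_def matched_def simp del: view_simps matched_view)
    then have "occupied c (cell x (-1)) (cell y (-1))" by (simp add: occupied_def)
    then have "q \<in> cells" using supported xy by (auto simp: cells_def)
    then show "q \<in> ?K" using xy(2) by (simp add: xy(3) view_view cell_cell)
  qed
  then have "card (?h ` ?L) \<le> card ?K"
    using finite_cells by (intro card_mono) auto
  moreover have "card (?h ` ?L) = card ?L"
    by (intro card_image inj_on_inverseI[where g = ?h]) (simp add: cell_cell)
  ultimately show ?thesis using finite_cells by (simp add: of_bool_def sum.If_cases Int_def)
qed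

lemma grid_conf_swap: "grid_conf (swap c) b a"
  using v supported by unfold_locales auto

lemma leak_ver:
  "(\<Sum>p\<in>cells. of_bool (leak (swap (view (fst p) (snd p) c)))) \<le> (\<Sum>p\<in>cells. of_bool (leak (view (-1) 0 (swap (view (fst p) (snd p) c)))) :: int)"
proof -
  interpret s: grid_conf "swap c" b a by (rule grid_conf_swap)
  have bij: "bij_betw prod.swap cells s.cells"
    by (rule bij_betw_byWitness[where f' = prod.swap]) (auto simp: cells_def s.cells_def)
  show ?thesis
    using s.leak_hor
    unfolding sum.reindex_bij_betw[OF bij, symmetric] by (simp add: swap_view)
qed

text \<open>
  In the sum of the balances over all cells the transfers cancel, except for the units absorbed by
  edges, one for each cell of positive level.
\<close>

lemma weight_bound: "12 * card reps + 5 * card matched_cells \<le> 24 * a * b"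
proof -
  have "(\<Sum>p\<in>cells. int (level_at c p)) = (\<Sum>p\<in>cells. int (level_at c p - 1) + of_bool (level_at c p \<noteq> 0))"
    by (intro sum.cong) (auto simp: of_nat_diff)
  also have "\<dots> = (\<Sum>p\<in>cells. int (level_at c p - 1)) + int (card payers)"
    using finite_cells by (simp add: sum.distrib of_bool_def sum.If_cases Int_def payers_def)
  finally have l: "(\<Sum>p\<in>cells. int (level_at c p)) = int (\<Sum>p\<in>cells. level_at c p - 1) + int (card payers)" by simp
  have "(\<Sum>p\<in>cells. balance (view (fst p) (snd p) c)) \<ge>
     6 * int (card reps) + 3 * int (card matched_cells) - 12 * int a * int b - int (card payers)"
    using leak_hor leak_ver l sum_excess arg_cong[OF sum_inflow, of int]
    unfolding balance_def by (simp add: sum.distrib sum_subtractf)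
  with sum_balance card_payers show ?thesis
    by (simp add: zle_int[symmetric] del: zle_int of_nat_le_iff)
qed

end

section \<open>Grid graphs as configurations\<close>

lemma verts_path: "verts (path_graph k) = {1..k}"
  by (simp add: path_graph_def)

lemma verts_grid: "verts (grid m n) = {1..m} \<times> {1..n}"
  by (simp add: grid_def box_product_def path_graph_def)

lemma edges_grid: "e \<in> edges (grid m n) \<longleftrightarrow>
    (\<exists>a b. e = {(a, b), (a + 1, b)} \<and> 1 \<le> a \<and> a + 1 \<le> m \<and> 1 \<le> b \<and> b \<le> n) \<or>
    (\<exists>a b. e = {(a, b), (a, b + 1)} \<and> 1 \<le> a \<and> a \<le> m \<and> 1 \<le> b \<and> b + 1 \<le> n)"
  (is "_ \<longleftrightarrow> ?H \<or> ?V")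
proof
  assume "e \<in> edges (grid m n)"
  then consider a b b' where "e = {(a, b), (a, b')}" "a \<in> {1..m}" "{b, b'} \<in> edges (path_graph n)"
    | a a' b where "e = {(a, b), (a', b)}" "{a, a'} \<in> edges (path_graph m)" "b \<in> {1..n}"
    by (auto simp: grid_def box_product_def verts_path)
  then show "?H \<or> ?V"
  proof cases
    case 1
    then show ?thesis by (auto simp: path_graph_def doubleton_eq_iff)
  next
    case 2
    then show ?thesis by (auto simp: path_graph_def doubleton_eq_iff)
  qed
next
  have path: "{i, i + 1} \<in> edges (path_graph k)" if "1 \<le> i" "i + 1 \<le> k" for i k
    using that by (auto simp: path_graph_def)
  assume "?H \<or> ?V"
  then show "e \<in> edges (grid m n)"
  proof
    assume ?H
    then obtain a b where "e = {(a, b), (a + 1, b)}" "{a, a + 1} \<in> edges (path_graph m)" "b \<in> verts (path_graph n)"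
      using path by (auto simp: verts_path)
    then show ?thesis unfolding grid_def box_product_def by (simp, blast)
  next
    assume ?V
    then obtain a b where "e = {(a, b), (a, b + 1)}" "{b, b + 1} \<in> edges (path_graph n)" "a \<in> verts (path_graph m)"
      using path by (auto simp: verts_path)
    then show ?thesis unfolding grid_def box_product_def by (simp, blast)
  qed
qed

text \<open>
  The vertices of the grid start at \<open>(1, 1)\<close>, the cells at \<open>(0, 0)\<close>, so that a block starts at an
  even cell. The guards \<open>0 \<le> x\<close> and \<open>0 \<le> y\<close> below keep \<open>nat\<close> from identifying cells.
\<close>

definition vtx :: "int \<Rightarrow> int \<Rightarrow> nat \<times> nat" where
  "vtx x y = (nat (x + 1), nat (y + 1))"

definition conf_of :: "(nat \<times> nat) set \<Rightarrow> (nat \<times> nat) set set \<Rightarrow> configuration" where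
  "conf_of T M = \<lparr>rep = \<lambda>x y. 0 \<le> x \<and> 0 \<le> y \<and> vtx x y \<in> T,
     hor = \<lambda>x y. 0 \<le> x \<and> 0 \<le> y \<and> {vtx x y, vtx (x + 1) y} \<in> M,
     ver = \<lambda>x y. 0 \<le> x \<and> 0 \<le> y \<and> {vtx x y, vtx x (y + 1)} \<in> M\<rparr>"

lemma rep_conf: "rep (conf_of T M) x y \<longleftrightarrow> 0 \<le> x \<and> 0 \<le> y \<and> vtx x y \<in> T"
  by (simp add: conf_of_def)

lemma vtx_inj: "0 \<le> x \<Longrightarrow> 0 \<le> y \<Longrightarrow> 0 \<le> x' \<Longrightarrow> 0 \<le> y' \<Longrightarrow> vtx x y = vtx x' y' \<longleftrightarrow> x = x' \<and> y = y'"
  by (auto simp: vtx_def)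

context
  fixes T M m n
  assumes pair: "feasible_representative_pair (grid m n) T M"
begin

lemma M_sub: "M \<subseteq> edges (grid m n)" and M_dis: "pairwise disjnt M"
  and T_sub: "T \<subseteq> verts (grid m n)" and T_M_disjoint: "T \<inter> \<Union> M = {}"
  and T_deg: "t \<in> T \<Longrightarrow> card (nbhd (grid m n) t \<inter> (T \<union> \<Union> M)) \<le> 1"
  using pair by (auto simp: feasible_representative_pair_def is_matching_def)

lemma Union_M_sub: "\<Union> M \<subseteq> verts (grid m n)"
proof
  fix p assume "p \<in> \<Union> M"
  then obtain e where "e \<in> edges (grid m n)" "p \<in> e" using M_sub by blast
  then show "p \<in> verts (grid m n)" by (auto simp: edges_grid verts_grid)
qed

lemma finite_TM: "finite T" "finite (\<Union> M)" "finite M"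
proof -
  have f: "finite (verts (grid m n))" by (simp add: verts_grid)
  show "finite T" "finite (\<Union> M)" using T_sub Union_M_sub f finite_subset by blast+
  then show "finite M" by (rule_tac finite_UnionD)
qed

lemma matched_conf: "matched (conf_of T M) x y \<longleftrightarrow> 0 \<le> x \<and> 0 \<le> y \<and> vtx x y \<in> \<Union> M"
proof
  assume w: "matched (conf_of T M) x y"
  then show "0 \<le> x \<and> 0 \<le> y \<and> vtx x y \<in> \<Union> M"
    by (auto simp: matched_def conf_of_def)
next
  assume a: "0 \<le> x \<and> 0 \<le> y \<and> vtx x y \<in> \<Union> M"
  then obtain e where e: "e \<in> M" "vtx x y \<in> e" by blast
  have "e \<in> edges (grid m n)" using e(1) M_sub by (rule_tac subsetD)
  then consider a b where "e = {(a, b), (a + 1, b)}" "1 \<le> a" "1 \<le> b"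
    | a b where "e = {(a, b), (a, b + 1)}" "1 \<le> a" "1 \<le> b"
    unfolding edges_grid by metis
  then show "matched (conf_of T M) x y"
  proof cases
    case 1
    from e(2) 1 a consider "(a, b) = vtx x y" | "(a + 1, b) = vtx x y" by auto
    then show ?thesis
    proof cases
      case 1
      then have "(a + 1, b) = vtx (x + 1) y" using a by (auto simp: vtx_def nat_add_distrib)
      then have "hor (conf_of T M) x y" using 1 e(1) a \<open>e = _\<close> by (simp add: conf_of_def)
      then show ?thesis by (simp add: matched_def)
    next
      case 2
      then have x: "a = nat x" "1 \<le> x" "b = nat (y + 1)" using a \<open>1 \<le> a\<close> by (auto simp: vtx_def nat_add_distrib)
      then have "(a, b) = vtx (x - 1) y" by (simp add: vtx_def)
      then have "hor (conf_of T M) (x - 1) y" using 2 e(1) a x(2) \<open>e = _\<close> by (simp add: conf_of_def)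
      then show ?thesis by (simp add: matched_def)
    qed
  next
    case 2
    from e(2) 2 a consider "(a, b) = vtx x y" | "(a, b + 1) = vtx x y" by auto
    then show ?thesis
    proof cases
      case 1
      then have "(a, b + 1) = vtx x (y + 1)" using a by (auto simp: vtx_def nat_add_distrib)
      then have "ver (conf_of T M) x y" using 1 e(1) a \<open>e = _\<close> by (simp add: conf_of_def)
      then show ?thesis by (simp add: matched_def)
    next
      case 2
      then have x: "b = nat y" "1 \<le> y" "a = nat (x + 1)" using a \<open>1 \<le> b\<close> by (auto simp: vtx_def nat_add_distrib)
      then have "(a, b) = vtx x (y - 1)" by (simp add: vtx_def)
      then have "ver (conf_of T M) x (y - 1)" using 2 e(1) a x(2) \<open>e = _\<close> by (simp add: conf_of_def)
      then show ?thesis by (simp add: matched_def)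
    qed
  qed
qed

lemma occupied_conf: "occupied (conf_of T M) x y \<longleftrightarrow> 0 \<le> x \<and> 0 \<le> y \<and> vtx x y \<in> T \<union> \<Union> M"
  unfolding occupied_def matched_conf by (auto simp: conf_of_def)

lemma occupied_range: "occupied (conf_of T M) x y \<Longrightarrow> 0 \<le> x \<and> x < int m \<and> 0 \<le> y \<and> y < int n"
proof -
  assume "occupied (conf_of T M) x y"
  then have "0 \<le> x \<and> 0 \<le> y" "vtx x y \<in> verts (grid m n)"
    using T_sub Union_M_sub unfolding occupied_conf by blast+
  then show ?thesis by (auto simp: verts_grid vtx_def)
qed

lemma M_meet: "e \<in> M \<Longrightarrow> f \<in> M \<Longrightarrow> p \<in> e \<Longrightarrow> p \<in> f \<Longrightarrow> e = f"
  using M_dis by (auto simp: pairwise_def disjnt_def)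

lemma adj_unique:
  assumes t: "t \<in> T" and "u \<in> T \<union> \<Union> M" "w \<in> T \<union> \<Union> M" "{u, t} \<in> edges (grid m n)" "{w, t} \<in> edges (grid m n)"
  shows "u = w"
proof -
  let ?A = "nbhd (grid m n) t \<inter> (T \<union> \<Union> M)"
  have "finite ?A" using finite_TM by simp
  moreover have "u \<in> ?A" "w \<in> ?A" using assms by (auto simp: nbhd_def)
  ultimately show ?thesis using T_deg[OF t] card_le_Suc0_iff_eq[of ?A] by simp
qed

lemma adj_grid:
  assumes "occupied (conf_of T M) x y" "occupied (conf_of T M) x' y'" "\<bar>x - x'\<bar> + \<bar>y - y'\<bar> = 1"
  shows "{vtx x' y', vtx x y} \<in> edges (grid m n)"
proof -
  note r = occupied_range[OF assms(1)] occupied_range[OF assms(2)]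
  have step: "{vtx (x + 1) y, vtx x y} \<in> edges (grid m n)"
    if "0 \<le> x" "x + 1 < int m" "0 \<le> y" "y < int n" for x y
  proof -
    have "vtx x y = (nat (x + 1), nat (y + 1)) \<and> vtx (x + 1) y = (nat (x + 1) + 1, nat (y + 1))"
      "1 \<le> nat (x + 1)" "nat (x + 1) + 1 \<le> m" "1 \<le> nat (y + 1)" "nat (y + 1) \<le> n"
      using that unfolding vtx_def by auto
    then show ?thesis unfolding edges_grid insert_commute[of _ "vtx x y"] by metis
  qed
  have step': "{vtx x (y + 1), vtx x y} \<in> edges (grid m n)"
    if "0 \<le> x" "x < int m" "0 \<le> y" "y + 1 < int n" for x y
  proof -
    have "vtx x y = (nat (x + 1), nat (y + 1)) \<and> vtx x (y + 1) = (nat (x + 1), nat (y + 1) + 1)"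
      "1 \<le> nat (x + 1)" "nat (x + 1) \<le> m" "1 \<le> nat (y + 1)" "nat (y + 1) + 1 \<le> n"
      using that unfolding vtx_def by auto
    then show ?thesis unfolding edges_grid insert_commute[of _ "vtx x y"] by metis
  qed
  consider "x' = x + 1" "y' = y" | "x = x' + 1" "y' = y" | "x' = x" "y' = y + 1" | "x' = x" "y = y' + 1"
    using assms(3) by linarith
  then show ?thesis
  proof cases
    case 1
    then show ?thesis using step[of x y] r by simp
  next
    case 2
    then show ?thesis using step[of x' y] r by (simp add: insert_commute[of "vtx x' y"])
  next
    case 3
    then show ?thesis using step'[of x y] r by simp
  next
    case 4
    then show ?thesis using step'[of x y'] r by (simp add: insert_commute[of "vtx x y'"])
  qed
qed

lemma rep_nbrs:
  assumes "rep (conf_of T M) x y" "occupied (conf_of T M) x1 y1" "occupied (conf_of T M) x2 y2"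
    "\<bar>x - x1\<bar> + \<bar>y - y1\<bar> = 1" "\<bar>x - x2\<bar> + \<bar>y - y2\<bar> = 1"
  shows "x1 = x2 \<and> y1 = y2"
proof -
  have s: "occupied (conf_of T M) x y" using assms(1) by (simp add: occupied_def)
  have "vtx x y \<in> T" using assms(1) by (simp add: conf_of_def)
  moreover have "vtx x1 y1 \<in> T \<union> \<Union> M" "vtx x2 y2 \<in> T \<union> \<Union> M"
    using assms(2,3) occupied_conf by blast+
  ultimately have "vtx x1 y1 = vtx x2 y2"
    using adj_grid[OF s assms(2,4)] adj_grid[OF s assms(3,5)] by (rule adj_unique)
  then show ?thesis using assms(2,3) vtx_inj occupied_conf by blast
qed

lemma valid_conf: "valid (conf_of T M)"
proof -
  let ?c = "conf_of T M"
  have hh: "\<not> hor ?c (x - 1) y" if "hor ?c x y" for x y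
  proof
    assume "hor ?c (x - 1) y"
    then have e: "{vtx x y, vtx (x + 1) y} \<in> M" "{vtx (x - 1) y, vtx x y} \<in> M" "x \<ge> 1" "y \<ge> 0"
      using that by (auto simp: conf_of_def)
    from M_meet[OF e(1,2), of "vtx x y"] e(3,4) show False by (simp add: doubleton_eq_iff vtx_inj)
  qed
  have vv: "\<not> ver ?c x (y - 1)" if "ver ?c x y" for x y
  proof
    assume "ver ?c x (y - 1)"
    then have e: "{vtx x y, vtx x (y + 1)} \<in> M" "{vtx x (y - 1), vtx x y} \<in> M" "y \<ge> 1" "x \<ge> 0"
      using that by (auto simp: conf_of_def)
    from M_meet[OF e(1,2), of "vtx x y"] e(3,4) show False by (simp add: doubleton_eq_iff vtx_inj)
  qed
  have hv: "\<not> (hor ?c a y \<and> ver ?c x b)" if "a = x \<or> a = x - 1" "b = y \<or> b = y - 1" for x y a b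
  proof
    assume h: "hor ?c a y \<and> ver ?c x b"
    then have e: "{vtx a y, vtx (a + 1) y} \<in> M" "{vtx x b, vtx x (b + 1)} \<in> M" "a \<ge> 0" "y \<ge> 0" "x \<ge> 0" "b \<ge> 0"
      by (auto simp: conf_of_def)
    have "vtx x y \<in> {vtx a y, vtx (a + 1) y}" "vtx x y \<in> {vtx x b, vtx x (b + 1)}"
      using that by auto
    from M_meet[OF e(1,2) this] e(3-6) show False by (auto simp: doubleton_eq_iff vtx_inj)
  qed
  have rw: "\<not> matched ?c x y" if "rep ?c x y" for x y
    using that T_M_disjoint unfolding matched_conf by (auto simp: conf_of_def)
  have nb: "\<not> (occupied ?c x1 y1 \<and> occupied ?c x2 y2)"
    if "rep ?c x y" "\<bar>x - x1\<bar> + \<bar>y - y1\<bar> = 1" "\<bar>x - x2\<bar> + \<bar>y - y2\<bar> = 1" "x1 \<noteq> x2 \<or> y1 \<noteq> y2" for x y x1 y1 x2 y2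
    using rep_nbrs[of x y x1 y1 x2 y2] that by blast
  show ?thesis
    unfolding valid_def
  proof (intro allI conjI impI)
    fix x y
    show "\<not> matched ?c x y" if "rep ?c x y" using rw that by blast
    show "\<not> hor ?c (x - 1) y" if "hor ?c x y" using hh that by blast
    show "\<not> ver ?c x (y - 1)" if "ver ?c x y" using vv that by blast
    show "\<not> ver ?c x y" if "hor ?c x y \<or> hor ?c (x - 1) y" using hv[of x x y y] hv[of "x - 1" x y y] that by blast
    show "\<not> ver ?c x (y - 1)" if "hor ?c x y \<or> hor ?c (x - 1) y" using hv[of x x "y - 1" y] hv[of "x - 1" x "y - 1" y] that by blast
    assume r: "rep ?c x y"
    show "\<not> (occupied ?c (x + 1) y \<and> occupied ?c (x - 1) y)" "\<not> (occupied ?c x (y + 1) \<and> occupied ?c x (y - 1))"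
       "\<not> ((occupied ?c (x + 1) y \<or> occupied ?c (x - 1) y) \<and> (occupied ?c x (y + 1) \<or> occupied ?c x (y - 1)))"
      using nb[OF r, of "x + 1" y "x - 1" y] nb[OF r, of x "y + 1" x "y - 1"] nb[OF r, of "x + 1" y x "y + 1"]
       nb[OF r, of "x + 1" y x "y - 1"] nb[OF r, of "x - 1" y x "y + 1"] nb[OF r, of "x - 1" y x "y - 1"]
      by auto
  qed
qed

lemma card_Union_M: "card (\<Union> M) = 2 * card M"
proof -
  have e: "card e = 2 \<and> finite e" if "e \<in> M" for e
  proof -
    have "e \<in> edges (grid m n)" using that M_sub by (rule_tac subsetD)
    then show ?thesis by (auto simp: edges_grid)
  qed
  have "card (\<Union> M) = sum card M"
    using M_dis e by (intro card_Union_disjoint) auto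
  also have "\<dots> = 2 * card M"
    using e by simp
  finally show ?thesis .
qed

lemma pair_bound:
  assumes "even m" "even n"
  shows "6 * card T + 5 * card M \<le> 3 * m * n"
proof -
  obtain a b where ab: "m = 2 * a" "n = 2 * b" using assms by (auto elim!: evenE)
  interpret g: grid_conf "conf_of T M" a b
  proof
    show "valid (conf_of T M)" by (rule valid_conf)
    show "x \<in> {0..<2 * int a} \<and> y \<in> {0..<2 * int b}" if "occupied (conf_of T M) x y" for x y
      using occupied_range[OF that] by (simp add: ab)
  qed
  have im: "card {p \<in> g.cells. vtx (fst p) (snd p) \<in> A} = card A" if "A \<subseteq> verts (grid m n)" for A
  proof -
    have "bij_betw (\<lambda>p. vtx (fst p) (snd p)) {p \<in> g.cells. vtx (fst p) (snd p) \<in> A} A"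
    proof (rule bij_betw_byWitness[where f' = "\<lambda>q. (int (fst q) - 1, int (snd q) - 1)"])
      show "(\<lambda>q. (int (fst q) - 1, int (snd q) - 1)) ` A \<subseteq> {p \<in> g.cells. vtx (fst p) (snd p) \<in> A}"
      proof
        fix p assume "p \<in> (\<lambda>q. (int (fst q) - 1, int (snd q) - 1)) ` A"
        then obtain i j where "(i, j) \<in> A" "p = (int i - 1, int j - 1)" by auto
        moreover from this have "(i, j) \<in> verts (grid m n)" using that by blast
        ultimately show "p \<in> {p \<in> g.cells. vtx (fst p) (snd p) \<in> A}"
          by (simp add: g.cells_def ab verts_grid vtx_def)
      qed
    qed (auto simp: g.cells_def vtx_def)
    then show ?thesis by (rule bij_betw_same_card)
  qed
  have "g.reps = {p \<in> g.cells. vtx (fst p) (snd p) \<in> T}"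
    unfolding g.reps_def rep_conf by (auto simp: g.cells_def)
  then have "card g.reps = card T" using im[OF T_sub] by simp
  moreover have "g.matched_cells = {p \<in> g.cells. vtx (fst p) (snd p) \<in> \<Union> M}"
    unfolding g.matched_cells_def matched_conf by (auto simp: g.cells_def)
  then have "card g.matched_cells = 2 * card M" using im[OF Union_M_sub] card_Union_M by simp
  ultimately have "12 * card T + 10 * card M \<le> 24 * a * b"
    using g.weight_bound by simp
  then show ?thesis by (simp add: ab)
qed

end

section \<open>The value of F and colorings\<close>

lemma F_even:
  assumes "even m" "even n"
  shows "real_of_int (F m n) = real m * real n / 2"
proof -
  have *: "\<lceil>2 * real k / 3\<rceil> + \<lfloor>real k / 3\<rfloor> = int k" for k :: nat
  proof -
    have "- (2 * real k / 3) = real k / 3 - of_int (int k)" by simp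
    then have "\<lceil>2 * real k / 3\<rceil> = int k - \<lfloor>real k / 3\<rfloor>"
      unfolding ceiling_def by (simp only: floor_diff_of_int minus_diff_eq)
    then show ?thesis by simp
  qed
  obtain a b where ab: "m = 2 * a" "n = 2 * b" using assms by (auto elim!: evenE)
  have "\<lceil>real m / 2\<rceil> = int a" "\<lfloor>real m / 2\<rfloor> = int a" "\<lceil>real n / 2\<rceil> = int b" "\<lfloor>real n / 2\<rfloor> = int b"
    by (simp_all add: ab)
  then have "F m n = max (int a * (\<lceil>2 * real n / 3\<rceil> + \<lfloor>real n / 3\<rfloor>)) (int b * (\<lceil>2 * real m / 3\<rceil> + \<lfloor>real m / 3\<rfloor>))"
    unfolding F_def by (simp add: distrib_left)
  also have "\<dots> = int (2 * a * b)" unfolding * by (simp add: ab)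
  finally show ?thesis by (simp add: ab)
qed

text \<open>
  A color class that contains an edge of \<open>G\<close> contributes an edge to \<open>M\<close>, and any other class a
  vertex to \<open>T\<close>. A class that contributes an edge has at least two elements.
\<close>

lemma quorum_pair:
  assumes f: "sub_quorum_coloring G k f" and fin: "finite (verts G)"
    and sym: "\<And>u v. {u, v} \<in> edges G \<Longrightarrow> u \<noteq> v"
  shows "\<exists>T M. feasible_representative_pair G T M \<and> card T + card M = k \<and>
    card M \<le> card {C \<in> color_classes f. \<not> is_singleton C}"
proof -
  define cls where "cls i = {v. f v = Some i}" for i
  define I where "I = {i \<in> {1..k}. \<exists>u v. f u = Some i \<and> f v = Some i \<and> {u, v} \<in> edges G}"
  define J where "J = {1..k} - I"
  have dom: "dom f \<subseteq> verts G" and ran: "ran f = {1..k}"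
    and q: "\<And>v. v \<in> dom f \<Longrightarrow> real (card {u \<in> closed_nbhd G v \<inter> dom f. f u = f v})
                   \<ge> 1 / 2 * real (card (closed_nbhd G v \<inter> dom f))"
    using f by (auto simp: sub_quorum_coloring_def)
  have fd: "finite (dom f)" using dom fin by (rule finite_subset)
  have "\<forall>i\<in>I. \<exists>e. e \<in> edges G \<and> e \<subseteq> cls i \<and> e \<noteq> {}"
    by (force simp: I_def cls_def)
  then obtain e where e: "\<And>i. i \<in> I \<Longrightarrow> e i \<in> edges G \<and> e i \<subseteq> cls i \<and> e i \<noteq> {}" by metis
  have "\<forall>i\<in>J. \<exists>t. f t = Some i"
    using ran by (auto simp: J_def ran_def)
  then obtain t where t: "\<And>i. i \<in> J \<Longrightarrow> f (t i) = Some i" by metis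
  define T where "T = t ` J"
  define M where "M = e ` I"
  have sub: "T \<union> \<Union> M \<subseteq> dom f"
    using e t by (force simp: T_def M_def cls_def)
  \<comment> \<open>The closed neighbourhood contains no other vertex of this color, so the quorum condition bounds it by 2.\<close>
  have deg: "card (nbhd G v \<inter> dom f) \<le> 1" if i: "i \<in> J" and v: "f v = Some i" for v i
  proof -
    have vd: "v \<in> dom f" using v by auto
    have vn: "v \<notin> nbhd G v" using sym[of v v] by (auto simp: nbhd_def)
    have "{u \<in> closed_nbhd G v \<inter> dom f. f u = f v} = {v}"
      using i v vd by (auto simp: J_def I_def closed_nbhd_def nbhd_def)
    then have "card (closed_nbhd G v \<inter> dom f) \<le> 2" using q[OF vd] by simp
    moreover have "closed_nbhd G v \<inter> dom f = insert v (nbhd G v \<inter> dom f)"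
      using vd by (auto simp: closed_nbhd_def)
    moreover have "card (insert v (nbhd G v \<inter> dom f)) = Suc (card (nbhd G v \<inter> dom f))"
      using fd vn by (intro card_insert_disjoint) auto
    ultimately show ?thesis by simp
  qed
  have same: "i = j" if "i \<in> I" "j \<in> I" "v \<in> e i" "v \<in> e j" for i j v
    using e[of i] e[of j] that by (auto simp: cls_def subset_iff)
  have "feasible_representative_pair G T M"
    unfolding feasible_representative_pair_def is_matching_def
  proof (intro conjI ballI)
    show "M \<subseteq> edges G" using e by (auto simp: M_def)
    show "pairwise disjnt M"
      using same by (auto simp: M_def pairwise_def disjnt_def)
    show "T \<subseteq> verts G" using sub dom by blast
    show "T \<inter> \<Union> M = {}"
    proof -
      have False if "i \<in> I" "j \<in> J" "t j \<in> e i" for i j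
        using e[of i] t[of j] that by (auto simp: cls_def J_def subset_iff)
      then show ?thesis by (auto simp: M_def T_def)
    qed
    fix v assume "v \<in> T"
    then obtain i where "i \<in> J" "f v = Some i" using t by (auto simp: T_def)
    then have "card (nbhd G v \<inter> dom f) \<le> 1" by (rule deg)
    moreover have "card (nbhd G v \<inter> (T \<union> \<Union> M)) \<le> card (nbhd G v \<inter> dom f)"
      using sub fd by (intro card_mono) auto
    ultimately show "card (nbhd G v \<inter> (T \<union> \<Union> M)) \<le> 1" by simp
  qed
  moreover have injt: "inj_on t J"
    by (rule inj_onI) (metis t option.inject)
  have inje: "inj_on e I"
  proof (rule inj_onI)
    fix i j assume ij: "i \<in> I" "j \<in> I" "e i = e j"
    then obtain v where "v \<in> e i" "v \<in> e j" using e by blast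
    then show "i = j" using same ij by blast
  qed
  have "card T + card M = card J + card I"
    unfolding T_def M_def using injt inje by (simp add: card_image)
  moreover have "card J + card I = k"
  proof -
    have "{1..k} = J \<union> I" "J \<inter> I = {}" by (auto simp: J_def I_def)
    moreover have "finite J" "finite I" by (auto simp: J_def I_def)
    ultimately have "card {1..k} = card J + card I" by (simp only: card_Un_disjoint)
    then show ?thesis by simp
  qed
  moreover have "card M \<le> card {C \<in> color_classes f. \<not> is_singleton C}"
  proof -
    have "finite (color_classes f)"
      unfolding color_classes_def ran by simp
    moreover have "inj_on cls I"
    proof (rule inj_onI)
      fix i j assume ij: "i \<in> I" "j \<in> I" "cls i = cls j"
      then obtain v where "v \<in> cls i" "v \<in> cls j" using e by blast
      then show "i = j" by (simp add: cls_def)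
    qed
    moreover have "cls ` I \<subseteq> {C \<in> color_classes f. \<not> is_singleton C}"
    proof
      fix C assume "C \<in> cls ` I"
      then obtain i u v where C: "C = cls i" "i \<in> {1..k}" "u \<in> C" "v \<in> C" "{u, v} \<in> edges G"
        by (auto simp: I_def cls_def)
      then have "C \<in> color_classes f" unfolding color_classes_def ran cls_def by blast
      moreover have "\<not> is_singleton C" using C(3,4) sym[OF C(5)] by (auto elim!: is_singletonE)
      ultimately show "C \<in> {C \<in> color_classes f. \<not> is_singleton C}" by blast
    qed
    ultimately have "card I \<le> card {C \<in> color_classes f. \<not> is_singleton C}"
      by (intro card_inj_on_le) auto
    then show ?thesis unfolding M_def using inje by (simp add: card_image)
  qed
  ultimately show ?thesis by auto
qed

theorem theorem5p5:
  fixes m n :: nat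
  assumes "m > 0" and "n > 0" and "even m" and "even n"
  shows "(\<forall>T M. feasible_representative_pair (grid m n) T M \<longrightarrow>
            real (card T) + 5 / 6 * real (card M) \<le> real m * real n / 2 \<and>
            (\<forall>q::real. q = real (card T) + real (card M) - real m * real n / 2 \<longrightarrow>
               real m * real n / 2 - real (card T) \<ge> 5 * q \<and>
               real (card M) \<ge> 6 * q)) \<and>
         real_of_int (F m n) = real m * real n / 2 \<and>
         (\<forall>(d::int) (k::nat) f. d \<ge> 1 \<longrightarrow> int k = F m n + d \<longrightarrow>
            sub_quorum_coloring (grid m n) k f \<longrightarrow>
            int (card {C \<in> color_classes f. \<not> is_singleton C}) \<ge> 6 * d)"
proof -
  have bound: "real (card T) + 5 / 6 * real (card M) \<le> real m * real n / 2"
    if "feasible_representative_pair (grid m n) T M" for T M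
  proof -
    have "real (6 * card T + 5 * card M) \<le> real (3 * m * n)"
      using pair_bound[OF that assms(3,4)] by (simp only: of_nat_le_iff)
    then show ?thesis by simp
  qed
  have Fmn: "real_of_int (F m n) = real m * real n / 2" using assms by (intro F_even)
  have "int (card {C \<in> color_classes f. \<not> is_singleton C}) \<ge> 6 * d"
    if k: "int k = F m n + d" and f: "sub_quorum_coloring (grid m n) k f" for d k f
  proof -
    have "finite (verts (grid m n))" by (simp add: verts_grid)
    moreover have "u \<noteq> v" if "{u, v} \<in> edges (grid m n)" for u v
      using that unfolding edges_grid by (auto simp: doubleton_eq_iff)
    ultimately obtain T M where TM: "feasible_representative_pair (grid m n) T M" "card T + card M = k"
      "card M \<le> card {C \<in> color_classes f. \<not> is_singleton C}"
      using quorum_pair[OF f] by blast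
    have "real (card T) + real (card M) = real_of_int (F m n) + real_of_int d"
      using k TM(2) by (metis of_int_add of_int_of_nat_eq of_nat_add)
    then have "real_of_int (6 * d) \<le> real (card M)"
      using bound[OF TM(1)] Fmn by simp
    then have "6 * d \<le> int (card M)" by linarith
    with TM(3) show ?thesis by linarith
  qed
  with bound Fmn show ?thesis by fastforce
qed

end
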